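(* Let $V$ be a nontrivial finite-dimensional irreducible $\boxtimes$-module over $\mathbb F$, and write $V$ as a tensor product of evaluation modules: $$V=V_{d_1}(a_1)\otimes V_{d_2}(a_2)\otimes\cdots\otimes V_{d_N}(a_N).$$ Then the Drinfel'd polynomial $P_V$ is given by $$P_V=\prod_{j=1}^N(1-a_j\lambda)^{d_j}.$$
   Context: $\mathbb F$ is an algebraically closed field of characteristic $0$, $\mathbb I=\{0,1,2,3\}$, and $\lambda$ is an indeterminate. The tetrahedron algebra $\boxtimes$ is the Lie algebra over $\mathbb F$ with generators $\{x_{ij}\mid i,j\in\mathbb I,\ i\ne j\}$ and relations: (i) $x_{ij}+x_{ji}=0$ for distinct $i,j$; (ii) $[x_{ij},x_{jk}]=2x_{ij}+2x_{jk}$ for mutually distinct $i,j,k$; (iii) $[x_{ij},[x_{ij},[x_{ij},x_{k\ell}]]]=4[x_{ij},x_{k\ell}]$ for mutually distinct $i,j,k,\ell$. The trivial $\boxtimes$-module is the one-dimensional module on which $\boxtimes$ acts as $0$. Tensor products of $\boxtimes$-modules carry the usual action $\xi.(u\otimes v)=(\xi.u)\otimes v+u\otimes(\xi.v)$. Drinfel'd polynomial: let $V$ be a finite-dimensional irreducible $\boxtimes$-module. It is known that there is an integer $d\ge0$ (the diameter of $V$) such that every $x_{ij}$ is semisimple on $V$ with set of distinct eigenvalues $\{d-2n\mid0\le n\le d\}$. For $0\le n\le d$ let $V_n$ be the eigenspace of $x_{13}$ on $V$ for eigenvalue $2n-d$, and put $V_{-1}=V_{d+1}=0$; $V_0$ has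 dimension $1$. Set $e^+=\frac{x_{13}+x_{30}}2$ and $e^-=\frac{x_{31}+x_{12}}2$; then $e^+V_n\subseteq V_{n+1}$ and $e^-V_n\subseteq V_{n-1}$. For an integer $i\ge0$ the space $V_0$ is invariant under $(e^-)^i(e^+)^i$; let $\vartheta_i=\vartheta_i(V)$ be the corresponding eigenvalue (so $\vartheta_i=0$ for $i>d$). The Drinfel'd polynomial of $V$ is $$P_V=\sum_{i=0}^\infty\frac{(-1)^i\vartheta_i\lambda^i}{(i!)^2}\in\mathbb F[\lambda].$$ Evaluation modules: let $\mathfrak{sl}_2=\mathfrak{sl}_2(\mathbb F)$ with basis $e,f,h$, $[h,e]=2e$, $[h,f]=-2f$, $[e,f]=h$. Put $x=2e-h$, $y=-2f-h$, $z=h$. For $a\in\mathbb F\setminus\{0,1\}$ let $EV_a:\boxtimes\to\mathfrak{sl}_2$ be the (surjective) Lie algebra homomorphism with $x_{12}\mapsto x$, $x_{23}\mapsto y$, $x_{31}\mapsto z$, $x_{03}\mapsto ay+(a-1)z$, $x_{01}\mapsto(1-a^{-1})z-a^{-1}x$, $x_{02}\mapsto(1-a)^{-1}x+a(1-a)^{-1}y$. For $d\ge0$ let $V_d$ be the irreducible $\mathfrak{sl}_2$-module of dimension $d+1$. An evaluation module is a $\boxtimes$-module $V_d(a)$, with $d\ge 1$ an integer and $a\in\mathbb F\setminus\{0,1\}$, obtained from $V_d$ by pulling back the action via $EV_a$. *)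

theory Defs
  imports
    "HOL-Analysis.Determinants"
    "HOL-Computational_Algebra.Polynomial"
    "HOL-Library.Poly_Mapping"
    "HOL-Library.FuncSet"
begin

section \<open>Lie algebras and their modules\<close>

locale lie_algebra = vector_space scaleL
  for scaleL :: "'k::field \<Rightarrow> 'l::ab_group_add \<Rightarrow> 'l" +
  fixes bracket :: "'l \<Rightarrow> 'l \<Rightarrow> 'l"
  assumes bracket_add_left: "bracket (x + y) z = bracket x z + bracket y z"
    and bracket_add_right: "bracket x (y + z) = bracket x y + bracket x z"
    and bracket_scale_left: "bracket (scaleL c x) y = scaleL c (bracket x y)"
    and bracket_scale_right: "bracket x (scaleL c y) = scaleL c (bracket x y)"
    and bracket_self: "bracket x x = 0"
    and jacobi: "bracket x (bracket y z) + bracket y (bracket z x) + bracket z (bracket x y) = 0"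

definition lie_hom ::
  "('k::field \<Rightarrow> 'l::ab_group_add \<Rightarrow> 'l) \<Rightarrow> ('l \<Rightarrow> 'l \<Rightarrow> 'l) \<Rightarrow>
   ('k \<Rightarrow> 'm::ab_group_add \<Rightarrow> 'm) \<Rightarrow> ('m \<Rightarrow> 'm \<Rightarrow> 'm) \<Rightarrow> ('l \<Rightarrow> 'm) \<Rightarrow> bool"
  where "lie_hom scaleL brL scaleM brM \<phi> \<longleftrightarrow>
    Vector_Spaces.linear scaleL scaleM \<phi> \<and> (\<forall>x y. \<phi> (brL x y) = brM (\<phi> x) (\<phi> y))"

text \<open>
  The underlying space of a module is a subspace \<open>M\<close> of an ambient vector space, so that
  families of modules of varying dimension can be formed within a single type.
  The values of \<open>act\<close> outside \<open>M\<close> are irrelevant.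
\<close>

locale lie_module = lie_algebra scaleL bracket + V: vector_space scaleV
  for scaleL :: "'k::field \<Rightarrow> 'l::ab_group_add \<Rightarrow> 'l"
    and bracket :: "'l \<Rightarrow> 'l \<Rightarrow> 'l"
    and scaleV :: "'k \<Rightarrow> 'v::ab_group_add \<Rightarrow> 'v" +
  fixes M :: "'v set" and act :: "'l \<Rightarrow> 'v \<Rightarrow> 'v"
  assumes subspace_carrier: "V.subspace M"
    and act_closed: "v \<in> M \<Longrightarrow> act \<xi> v \<in> M"
    and act_add_right: "v \<in> M \<Longrightarrow> w \<in> M \<Longrightarrow> act \<xi> (v + w) = act \<xi> v + act \<xi> w"
    and act_scale_right: "v \<in> M \<Longrightarrow> act \<xi> (scaleV c v) = scaleV c (act \<xi> v)"
    and act_add_left: "v \<in> M \<Longrightarrow> act (\<xi> + \<eta>) v = act \<xi> v + act \<eta> v"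
    and act_scale_left: "v \<in> M \<Longrightarrow> act (scaleL c \<xi>) v = scaleV c (act \<xi> v)"
    and act_bracket: "v \<in> M \<Longrightarrow> act (bracket \<xi> \<eta>) v = act \<xi> (act \<eta> v) - act \<eta> (act \<xi> v)"

definition irreducible_module ::
  "('k::field \<Rightarrow> 'v::ab_group_add \<Rightarrow> 'v) \<Rightarrow> 'v set \<Rightarrow> ('l \<Rightarrow> 'v \<Rightarrow> 'v) \<Rightarrow> bool"
  where "irreducible_module scaleV M act \<longleftrightarrow>
    M \<noteq> {0} \<and>
    (\<forall>U. module.subspace scaleV U \<and> U \<subseteq> M \<and> (\<forall>\<xi>. \<forall>u\<in>U. act \<xi> u \<in> U)
       \<longrightarrow> U = {0} \<or> U = M)"

definition finite_dimensional_space ::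
  "('k::field \<Rightarrow> 'v::ab_group_add \<Rightarrow> 'v) \<Rightarrow> 'v set \<Rightarrow> bool"
  where "finite_dimensional_space scaleV M \<longleftrightarrow> (\<exists>B. finite B \<and> M = module.span scaleV B)"

definition trivial_module ::
  "('k::field \<Rightarrow> 'v::ab_group_add \<Rightarrow> 'v) \<Rightarrow> 'v set \<Rightarrow> ('l \<Rightarrow> 'v \<Rightarrow> 'v) \<Rightarrow> bool"
  where "trivial_module scaleV M act \<longleftrightarrow>
    vector_space.dim scaleV M = 1 \<and> (\<forall>\<xi>. \<forall>v\<in>M. act \<xi> v = 0)"


section \<open>Tensor products\<close>

text \<open>
  The finitely supported functions \<^typ>\<open>'x \<Rightarrow>\<^sub>0 'k\<close> form the free vector space on
  \<^typ>\<open>'x\<close>, with basis vectors \<open>Poly_Mapping.single x 1\<close>.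
\<close>

definition free_scale :: "'k::field \<Rightarrow> ('x \<Rightarrow>\<^sub>0 'k) \<Rightarrow> ('x \<Rightarrow>\<^sub>0 'k)"
  where "free_scale c p = Poly_Mapping.map (\<lambda>y. c * y) p"

definition free_extend ::
  "('k::field \<Rightarrow> 'v::ab_group_add \<Rightarrow> 'v) \<Rightarrow> ('x \<Rightarrow> 'v) \<Rightarrow> ('x \<Rightarrow>\<^sub>0 'k) \<Rightarrow> 'v"
  where "free_extend scaleV \<tau> p =
    (\<Sum>x\<in>Poly_Mapping.keys p. scaleV (Poly_Mapping.lookup p x) (\<tau> x))"

definition multilinear_relators ::
  "'i set \<Rightarrow> ('k::field \<Rightarrow> 'w::ab_group_add \<Rightarrow> 'w) \<Rightarrow> ('i \<Rightarrow> 'w set) \<Rightarrow> (('i \<Rightarrow> 'w) \<Rightarrow>\<^sub>0 'k) set"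
  where "multilinear_relators I scaleW W =
    {Poly_Mapping.single (u(j := x + y)) 1
       - Poly_Mapping.single (u(j := x)) 1 - Poly_Mapping.single (u(j := y)) 1
     | u j x y. u \<in> Pi\<^sub>E I W \<and> j \<in> I \<and> x \<in> W j \<and> y \<in> W j}
    \<union> {Poly_Mapping.single (u(j := scaleW c x)) 1 - free_scale c (Poly_Mapping.single (u(j := x)) 1)
     | u j c x. u \<in> Pi\<^sub>E I W \<and> j \<in> I \<and> x \<in> W j}"

text \<open>
  The space \<open>V\<close> is the tensor product of the spaces \<open>W j\<close>, \<open>j \<in> I\<close>, the pure tensor of the
  family \<open>u\<close> being \<open>\<tau> u\<close>: the linear extension of \<open>\<tau>\<close> to the free vector space on
  the product of the \<open>W j\<close> is onto \<open>V\<close>, and its kernel is spanned by the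
  relators that express multilinearity. Thus \<open>\<tau>\<close> identifies \<open>V\<close> with the usual
  quotient construction of the tensor product.
\<close>

definition is_tensor_product ::
  "'i set \<Rightarrow> ('k::field \<Rightarrow> 'w::ab_group_add \<Rightarrow> 'w) \<Rightarrow> ('i \<Rightarrow> 'w set) \<Rightarrow>
   ('k \<Rightarrow> 'v::ab_group_add \<Rightarrow> 'v) \<Rightarrow> 'v set \<Rightarrow> (('i \<Rightarrow> 'w) \<Rightarrow> 'v) \<Rightarrow> bool"
  where "is_tensor_product I scaleW W scaleV V \<tau> \<longleftrightarrow>
    free_extend scaleV \<tau> ` {p. Poly_Mapping.keys p \<subseteq> Pi\<^sub>E I W} = V \<and>
    {p. Poly_Mapping.keys p \<subseteq> Pi\<^sub>E I W \<and> free_extend scaleV \<tau> p = 0}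
      = module.span free_scale (multilinear_relators I scaleW W)"

definition is_module_tensor_product ::
  "'i set \<Rightarrow> ('k::field \<Rightarrow> 'w::ab_group_add \<Rightarrow> 'w) \<Rightarrow> ('i \<Rightarrow> 'w set) \<Rightarrow> ('i \<Rightarrow> 'l \<Rightarrow> 'w \<Rightarrow> 'w) \<Rightarrow>
   ('k \<Rightarrow> 'v::ab_group_add \<Rightarrow> 'v) \<Rightarrow> 'v set \<Rightarrow> ('l \<Rightarrow> 'v \<Rightarrow> 'v) \<Rightarrow> (('i \<Rightarrow> 'w) \<Rightarrow> 'v) \<Rightarrow> bool"
  where "is_module_tensor_product I scaleW W actW scaleV V act \<tau> \<longleftrightarrow>
    is_tensor_product I scaleW W scaleV V \<tau> \<and>
    (\<forall>\<xi>. \<forall>u\<in>Pi\<^sub>E I W. act \<xi> (\<tau> u) = (\<Sum>j\<in>I. \<tau> (u(j := actW j \<xi> (u j)))))"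


section \<open>The tetrahedron algebra\<close>

datatype tet_index = I0 | I1 | I2 | I3

datatype 'k tet_term =
    TGen tet_index tet_index
  | TZero
  | TAdd "'k tet_term" "'k tet_term"
  | TScale 'k "'k tet_term"
  | TBr "'k tet_term" "'k tet_term"

text \<open>
  Presentation by generators and relations: formal Lie expressions modulo the congruence
  generated by the Lie algebra axioms and the defining relations. The generators are the
  \<open>TGen i j\<close> with \<open>i \<noteq> j\<close>; the superfluous symbols \<open>TGen i i\<close> are set to \<open>0\<close>.
\<close>

inductive tet_rel :: "'k::field tet_term \<Rightarrow> 'k tet_term \<Rightarrow> bool" where
  tet_refl: "tet_rel s s"
| tet_sym: "tet_rel s t \<Longrightarrow> tet_rel t s"
| tet_trans: "tet_rel s t \<Longrightarrow> tet_rel t u \<Longrightarrow> tet_rel s u"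
| tet_cong_add: "tet_rel s s' \<Longrightarrow> tet_rel t t' \<Longrightarrow> tet_rel (TAdd s t) (TAdd s' t')"
| tet_cong_scale: "tet_rel s s' \<Longrightarrow> tet_rel (TScale c s) (TScale c s')"
| tet_cong_br: "tet_rel s s' \<Longrightarrow> tet_rel t t' \<Longrightarrow> tet_rel (TBr s t) (TBr s' t')"
| tet_add_assoc: "tet_rel (TAdd (TAdd s t) u) (TAdd s (TAdd t u))"
| tet_add_comm: "tet_rel (TAdd s t) (TAdd t s)"
| tet_add_zero: "tet_rel (TAdd TZero s) s"
| tet_add_neg: "tet_rel (TAdd (TScale (-1) s) s) TZero"
| tet_scale_add_right: "tet_rel (TScale c (TAdd s t)) (TAdd (TScale c s) (TScale c t))"
| tet_scale_add_left: "tet_rel (TScale (b + c) s) (TAdd (TScale b s) (TScale c s))"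
| tet_scale_scale: "tet_rel (TScale b (TScale c s)) (TScale (b * c) s)"
| tet_scale_one: "tet_rel (TScale 1 s) s"
| tet_br_add_left: "tet_rel (TBr (TAdd s t) u) (TAdd (TBr s u) (TBr t u))"
| tet_br_add_right: "tet_rel (TBr s (TAdd t u)) (TAdd (TBr s t) (TBr s u))"
| tet_br_scale_left: "tet_rel (TBr (TScale c s) t) (TScale c (TBr s t))"
| tet_br_scale_right: "tet_rel (TBr s (TScale c t)) (TScale c (TBr s t))"
| tet_br_self: "tet_rel (TBr s s) TZero"
| tet_jacobi: "tet_rel (TAdd (TAdd (TBr s (TBr t u)) (TBr t (TBr u s))) (TBr u (TBr s t))) TZero"
| tet_gen_diag: "tet_rel (TGen i i) TZero"
| tet_rel_i: "i \<noteq> j \<Longrightarrow> tet_rel (TAdd (TGen i j) (TGen j i)) TZero"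
| tet_rel_ii: "distinct [i, j, k] \<Longrightarrow>
    tet_rel (TBr (TGen i j) (TGen j k)) (TAdd (TScale 2 (TGen i j)) (TScale 2 (TGen j k)))"
| tet_rel_iii: "distinct [i, j, k, l] \<Longrightarrow>
    tet_rel (TBr (TGen i j) (TBr (TGen i j) (TBr (TGen i j) (TGen k l))))
            (TScale 4 (TBr (TGen i j) (TGen k l)))"

quotient_type (overloaded) 'k tetrahedron = "'k::field tet_term" / tet_rel
  by (rule equivpI) (auto simp: reflp_def symp_def transp_def intro: tet_refl tet_sym tet_trans)

instantiation tetrahedron :: (field) ab_group_add
begin

lift_definition zero_tetrahedron :: "'a tetrahedron" is TZero .

lift_definition plus_tetrahedron :: "'a tetrahedron \<Rightarrow> 'a tetrahedron \<Rightarrow> 'a tetrahedron" is TAdd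
  by (rule tet_cong_add)

lift_definition uminus_tetrahedron :: "'a tetrahedron \<Rightarrow> 'a tetrahedron" is "TScale (-1)"
  by (rule tet_cong_scale)

definition minus_tetrahedron :: "'a tetrahedron \<Rightarrow> 'a tetrahedron \<Rightarrow> 'a tetrahedron"
  where "minus_tetrahedron x y = x + (- y)"

instance
proof
  fix a b c :: "'a tetrahedron"
  show "a + b + c = a + (b + c)" by transfer (rule tet_add_assoc)
  show "a + b = b + a" by transfer (rule tet_add_comm)
  show "0 + a = a" by transfer (rule tet_add_zero)
  show "- a + a = 0" by transfer (rule tet_add_neg)
  show "a - b = a + (- b)" by (rule minus_tetrahedron_def)
qed

end

lift_definition tet_scale :: "'k::field \<Rightarrow> 'k tetrahedron \<Rightarrow> 'k tetrahedron" is TScale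
  by (rule tet_cong_scale)

lift_definition tet_bracket :: "'k::field tetrahedron \<Rightarrow> 'k tetrahedron \<Rightarrow> 'k tetrahedron" is TBr
  by (rule tet_cong_br)

lift_definition tet_x :: "tet_index \<Rightarrow> tet_index \<Rightarrow> 'k::field tetrahedron" is TGen .

interpretation tetrahedron: lie_algebra "tet_scale :: 'k::field \<Rightarrow> _" tet_bracket
proof
  fix b c :: 'k and x y z :: "'k tetrahedron"
  show "tet_scale c (x + y) = tet_scale c x + tet_scale c y"
    by transfer (rule tet_scale_add_right)
  show "tet_scale (b + c) x = tet_scale b x + tet_scale c x"
    by transfer (rule tet_scale_add_left)
  show "tet_scale b (tet_scale c x) = tet_scale (b * c) x"
    by transfer (rule tet_scale_scale)
  show "tet_scale 1 x = x"
    by transfer (rule tet_scale_one)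
  show "tet_bracket (x + y) z = tet_bracket x z + tet_bracket y z"
    by transfer (rule tet_br_add_left)
  show "tet_bracket x (y + z) = tet_bracket x y + tet_bracket x z"
    by transfer (rule tet_br_add_right)
  show "tet_bracket (tet_scale c x) y = tet_scale c (tet_bracket x y)"
    by transfer (rule tet_br_scale_left)
  show "tet_bracket x (tet_scale c y) = tet_scale c (tet_bracket x y)"
    by transfer (rule tet_br_scale_right)
  show "tet_bracket x x = 0"
    by transfer (rule tet_br_self)
  show "tet_bracket x (tet_bracket y z) + tet_bracket y (tet_bracket z x)
      + tet_bracket z (tet_bracket x y) = 0"
    by transfer (rule tet_jacobi)
qed

lemma tet_x_diag: "tet_x i i = 0"
  by transfer (rule tet_gen_diag)

lemma tet_x_antisym: "i \<noteq> j \<Longrightarrow> tet_x i j + tet_x j i = 0"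
  by transfer (rule tet_rel_i)

lemma tet_x_bracket: "distinct [i, j, k] \<Longrightarrow>
    tet_bracket (tet_x i j) (tet_x j k) = tet_scale 2 (tet_x i j) + tet_scale 2 (tet_x j k)"
  by transfer (rule tet_rel_ii)

lemma tet_x_dolan_grady: "distinct [i, j, k, l] \<Longrightarrow>
    tet_bracket (tet_x i j) (tet_bracket (tet_x i j) (tet_bracket (tet_x i j) (tet_x k l)))
      = tet_scale 4 (tet_bracket (tet_x i j) (tet_x k l))"
  by transfer (rule tet_rel_iii)

abbreviation tet_module ::
  "('k::field \<Rightarrow> 'v::ab_group_add \<Rightarrow> 'v) \<Rightarrow> 'v set \<Rightarrow> ('k tetrahedron \<Rightarrow> 'v \<Rightarrow> 'v) \<Rightarrow> bool"
  where "tet_module scaleV V act \<equiv> lie_module tet_scale tet_bracket scaleV V act"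


section \<open>The Lie algebra \<open>sl\<^sub>2\<close>\<close>

typedef (overloaded) ('k::comm_ring_1) sl2 = "{A :: 'k^2^2. trace A = 0}"
  by (rule exI[of _ 0]) (simp add: trace_def)

setup_lifting type_definition_sl2

instantiation sl2 :: (comm_ring_1) ab_group_add
begin

lift_definition zero_sl2 :: "'a sl2" is 0 by (simp add: trace_def)
lift_definition plus_sl2 :: "'a sl2 \<Rightarrow> 'a sl2 \<Rightarrow> 'a sl2" is "(+)" by (simp add: trace_add)
lift_definition minus_sl2 :: "'a sl2 \<Rightarrow> 'a sl2 \<Rightarrow> 'a sl2" is "(-)" by (simp add: trace_sub)
lift_definition uminus_sl2 :: "'a sl2 \<Rightarrow> 'a sl2" is uminus by (simp add: trace_def sum_negf)

instance by standard (transfer; simp)+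

end

lift_definition sl2_scale :: "'k::comm_ring_1 \<Rightarrow> 'k sl2 \<Rightarrow> 'k sl2"
  is "\<lambda>c A. \<chi> i j. c * A $ i $ j"
  by (simp add: trace_def flip: sum_distrib_left)

lift_definition sl2_bracket :: "'k::comm_ring_1 sl2 \<Rightarrow> 'k sl2 \<Rightarrow> 'k sl2"
  is "\<lambda>A B. A ** B - B ** A"
  by (metis cancel_comm_monoid_add_class.diff_cancel trace_mul_sym trace_sub)

lift_definition sl2_e :: "'k::comm_ring_1 sl2" is "vector [vector [0, 1], vector [0, 0]]"
  by (simp add: trace_def sum_2)
lift_definition sl2_f :: "'k::comm_ring_1 sl2" is "vector [vector [0, 0], vector [1, 0]]"
  by (simp add: trace_def sum_2)
lift_definition sl2_h :: "'k::comm_ring_1 sl2" is "vector [vector [1, 0], vector [0, -1]]"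
  by (simp add: trace_def sum_2)

lemma sl2_entry_22: "Rep_sl2 A $ 2 $ 2 = - (Rep_sl2 A $ 1 $ 1)"
  using Rep_sl2[of A] by (simp add: trace_def sum_2 eq_neg_iff_add_eq_0 add.commute)

lemma sl2_eq_iff:
  "A = B \<longleftrightarrow> Rep_sl2 A $ 1 $ 1 = Rep_sl2 B $ 1 $ 1 \<and> Rep_sl2 A $ 1 $ 2 = Rep_sl2 B $ 1 $ 2 \<and>
     Rep_sl2 A $ 2 $ 1 = Rep_sl2 B $ 2 $ 1"
  by (auto simp: Rep_sl2_inject[symmetric] vec_eq_iff forall_2 sl2_entry_22)

lemmas sl2_entries =
  sl2_entry_22 zero_sl2.rep_eq plus_sl2.rep_eq minus_sl2.rep_eq uminus_sl2.rep_eq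
  sl2_scale.rep_eq sl2_bracket.rep_eq sl2_e.rep_eq sl2_f.rep_eq sl2_h.rep_eq
  matrix_matrix_mult_def sum_2 vector_2

interpretation sl2: lie_algebra "sl2_scale :: 'k::field \<Rightarrow> _" sl2_bracket
  by unfold_locales (simp_all add: sl2_eq_iff sl2_entries algebra_simps)

lemma sl2_brackets:
  "sl2_bracket sl2_h sl2_e = sl2_scale 2 sl2_e"
  "sl2_bracket sl2_h sl2_f = sl2_scale (-2) sl2_f"
  "sl2_bracket sl2_e sl2_f = sl2_h"
  by (simp_all add: sl2_eq_iff sl2_entries)

definition sl2_x :: "'k::field sl2" where "sl2_x = sl2_scale 2 sl2_e - sl2_h"
definition sl2_y :: "'k::field sl2" where "sl2_y = sl2_scale (-2) sl2_f - sl2_h"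
definition sl2_z :: "'k::field sl2" where "sl2_z = sl2_h"


section \<open>Evaluation modules\<close>

definition is_EV :: "'k::field \<Rightarrow> ('k tetrahedron \<Rightarrow> 'k sl2) \<Rightarrow> bool"
  where "is_EV a \<phi> \<longleftrightarrow>
    lie_hom tet_scale tet_bracket sl2_scale sl2_bracket \<phi> \<and>
    \<phi> (tet_x I1 I2) = sl2_x \<and>
    \<phi> (tet_x I2 I3) = sl2_y \<and>
    \<phi> (tet_x I3 I1) = sl2_z \<and>
    \<phi> (tet_x I0 I3) = sl2_scale a sl2_y + sl2_scale (a - 1) sl2_z \<and>
    \<phi> (tet_x I0 I1) = sl2_scale (1 - inverse a) sl2_z - sl2_scale (inverse a) sl2_x \<and>
    \<phi> (tet_x I0 I2) = sl2_scale (inverse (1 - a)) sl2_x + sl2_scale (a * inverse (1 - a)) sl2_y"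

definition EV :: "'k::field \<Rightarrow> 'k tetrahedron \<Rightarrow> 'k sl2"
  where "EV a = (THE \<phi>. is_EV a \<phi>)"

text \<open>The homomorphism \<open>EV a\<close> exists and is unique for \<open>a \<notin> {0, 1}\<close>.\<close>

context
begin

private fun ev_gen :: "'k::field \<Rightarrow> tet_index \<Rightarrow> tet_index \<Rightarrow> 'k sl2" where
  "ev_gen a I1 I2 = sl2_x"
| "ev_gen a I2 I3 = sl2_y"
| "ev_gen a I3 I1 = sl2_z"
| "ev_gen a I0 I3 = sl2_scale a sl2_y + sl2_scale (a - 1) sl2_z"
| "ev_gen a I0 I1 = sl2_scale (1 - inverse a) sl2_z - sl2_scale (inverse a) sl2_x"
| "ev_gen a I0 I2 = sl2_scale (inverse (1 - a)) sl2_x + sl2_scale (a * inverse (1 - a)) sl2_y"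
| "ev_gen a I2 I1 = - sl2_x"
| "ev_gen a I3 I2 = - sl2_y"
| "ev_gen a I1 I3 = - sl2_z"
| "ev_gen a I3 I0 = - (sl2_scale a sl2_y + sl2_scale (a - 1) sl2_z)"
| "ev_gen a I1 I0 = - (sl2_scale (1 - inverse a) sl2_z - sl2_scale (inverse a) sl2_x)"
| "ev_gen a I2 I0 = - (sl2_scale (inverse (1 - a)) sl2_x + sl2_scale (a * inverse (1 - a)) sl2_y)"
| "ev_gen a _ _ = 0"

private primrec ev_term :: "'k::field \<Rightarrow> 'k tet_term \<Rightarrow> 'k sl2" where
  "ev_term a (TGen i j) = ev_gen a i j"
| "ev_term a TZero = 0"
| "ev_term a (TAdd s t) = ev_term a s + ev_term a t"
| "ev_term a (TScale c s) = sl2_scale c (ev_term a s)"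
| "ev_term a (TBr s t) = sl2_bracket (ev_term a s) (ev_term a t)"

private lemma sl2_bracket_cubed:
  assumes "Rep_sl2 A $ 1 $ 2 * Rep_sl2 A $ 2 $ 1 = 1 - Rep_sl2 A $ 1 $ 1 * Rep_sl2 A $ 1 $ 1"
  shows "sl2_bracket A (sl2_bracket A (sl2_bracket A B)) = sl2_scale 4 (sl2_bracket A B)"
proof -
  define u v w where "u = Rep_sl2 A $ 1 $ 1" "v = Rep_sl2 A $ 1 $ 2" "w = Rep_sl2 A $ 2 $ 1"
  note uvw = this[symmetric]
  have vw: "v * w = 1 - u * u"
    using assms by (simp add: uvw)
  have vw': "v * (w * r) = r - u * (u * r)" for r
  proof -
    have "v * (w * r) = (v * w) * r" by (simp only: mult.assoc)
    also have "\<dots> = r - u * (u * r)" by (simp only: vw left_diff_distrib mult_1_left mult.assoc)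
    finally show ?thesis .
  qed
  show ?thesis
    by (simp add: sl2_eq_iff sl2_entries uvw algebra_simps vw vw')
qed

private lemma ev_term_respects:
  assumes a: "a \<noteq> 0" "a \<noteq> 1" and st: "tet_rel s t"
  shows "ev_term a s = ev_term a t"
proof -
  define p where "p = inverse a"
  define q where "q = inverse (1 - a)"
  have pq: "a * p = 1" "a * q = q - 1" "p * q = p + q"
    using a by (simp_all add: p_def q_def field_simps)
  have pq': "a * (p * r) = r" "a * (q * r) = q * r - r" "p * (q * r) = p * r + q * r" for r
    by (simp_all add: pq algebra_simps flip: mult.assoc)
  show ?thesis
    using st
  proof induction
    case (tet_gen_diag i)
    show ?case by (cases i) simp_all
  next
    case (tet_rel_i i j)
    then show ?case by (cases i; cases j) simp_all
  next
    case (tet_rel_ii i j k)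
    then show ?case
      by (cases i; cases j; cases k)
        (simp_all add: sl2_eq_iff sl2_entries sl2_x_def sl2_y_def sl2_z_def algebra_simps pq pq'
          flip: p_def q_def)
  next
    case (tet_rel_iii i j k l)
    then have "Rep_sl2 (ev_gen a i j) $ 1 $ 2 * Rep_sl2 (ev_gen a i j) $ 2 $ 1
        = 1 - Rep_sl2 (ev_gen a i j) $ 1 $ 1 * Rep_sl2 (ev_gen a i j) $ 1 $ 1"
      by (cases i; cases j)
        (simp_all add: sl2_entries sl2_x_def sl2_y_def sl2_z_def algebra_simps pq pq'
          flip: p_def q_def)
    then show ?case
      by (simp add: sl2_bracket_cubed)
  qed (simp_all add: sl2_eq_iff sl2_entries algebra_simps)
qed

lemma EV_ex1:
  fixes a :: "'k::field"
  assumes a: "a \<noteq> 0" "a \<noteq> 1"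
  shows "\<exists>!\<phi>. is_EV a \<phi>"
proof (rule ex_ex1I)
  define \<phi> where "\<phi> X = ev_term a (rep_tetrahedron X)" for X
  have \<phi>_abs: "\<phi> (abs_tetrahedron t) = ev_term a t" for t
    unfolding \<phi>_def
    by (rule ev_term_respects[OF a])
      (rule rep_abs_rsp_left[OF Quotient3_tetrahedron tet_refl])
  have "lie_hom tet_scale tet_bracket sl2_scale sl2_bracket \<phi>"
    unfolding lie_hom_def
  proof (intro conjI allI)
    show "Vector_Spaces.linear tet_scale sl2_scale \<phi>"
    proof unfold_locales
      fix c and X Y :: "'k tetrahedron"
      obtain s t where "X = abs_tetrahedron s" "Y = abs_tetrahedron t"
        by (metis Quotient3_abs_rep Quotient3_tetrahedron)
      then show "\<phi> (X + Y) = \<phi> X + \<phi> Y" "\<phi> (tet_scale c X) = sl2_scale c (\<phi> X)"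
        by (simp_all add: plus_tetrahedron.abs_eq tet_scale.abs_eq \<phi>_abs)
    qed
    fix X Y :: "'k tetrahedron"
    obtain s t where "X = abs_tetrahedron s" "Y = abs_tetrahedron t"
      by (metis Quotient3_abs_rep Quotient3_tetrahedron)
    then show "\<phi> (tet_bracket X Y) = sl2_bracket (\<phi> X) (\<phi> Y)"
      by (simp add: tet_bracket.abs_eq \<phi>_abs)
  qed
  then have "is_EV a \<phi>"
    by (simp add: is_EV_def tet_x.abs_eq \<phi>_abs)
  then show "\<exists>\<phi>. is_EV a \<phi>" by blast
next
  fix \<phi> \<psi> :: "'k tetrahedron \<Rightarrow> 'k sl2"
  assume "is_EV a \<phi>" and "is_EV a \<psi>"
  have *: "\<eta> (abs_tetrahedron t) = ev_term a t" if \<eta>: "is_EV a \<eta>" for \<eta> t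
  proof -
    interpret \<eta>: Vector_Spaces.linear tet_scale sl2_scale \<eta>
      using \<eta> by (simp add: is_EV_def lie_hom_def)
    have neg: "tet_x i j = - (tet_x j i :: 'k tetrahedron)" if "i \<noteq> j" for i j
      using tet_x_antisym[OF that] by (simp add: eq_neg_iff_add_eq_0)
    have gen: "\<eta> (tet_x i j) = ev_gen a i j" for i j
      using \<eta> neg[of I2 I1] neg[of I3 I2] neg[of I1 I3] neg[of I3 I0] neg[of I1 I0] neg[of I2 I0]
      by (cases i; cases j) (simp_all add: is_EV_def tet_x_diag \<eta>.zero \<eta>.neg)
    have br: "\<eta> (tet_bracket X Y) = sl2_bracket (\<eta> X) (\<eta> Y)" for X Y
      using \<eta> by (simp add: is_EV_def lie_hom_def)
    show ?thesis
      by (induction t)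
        (simp_all add: gen br \<eta>.zero \<eta>.add \<eta>.scale flip: tet_x.abs_eq zero_tetrahedron.abs_eq
          plus_tetrahedron.abs_eq tet_scale.abs_eq tet_bracket.abs_eq)
  qed
  show "\<phi> = \<psi>"
  proof
    fix X :: "'k tetrahedron"
    obtain t where "X = abs_tetrahedron t"
      by (metis Quotient3_abs_rep Quotient3_tetrahedron)
    then show "\<phi> X = \<psi> X"
      using *[OF \<open>is_EV a \<phi>\<close>] *[OF \<open>is_EV a \<psi>\<close>] by simp
  qed
qed

end

text \<open>
  The module \<open>V\<^sub>d\<close> is determined up to isomorphism only, so \<open>V\<^sub>d(a)\<close> is rendered as a predicate:
  any irreducible \<open>sl\<^sub>2\<close>-module of dimension \<open>d + 1\<close> may serve as \<open>V\<^sub>d\<close>. Finite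
  dimensionality of \<open>W\<close> is implied, since \<open>dim\<close> is \<open>0\<close> on infinite-dimensional spaces.
\<close>

definition is_evaluation_module ::
  "nat \<Rightarrow> 'k::field \<Rightarrow> ('k \<Rightarrow> 'w::ab_group_add \<Rightarrow> 'w) \<Rightarrow> 'w set \<Rightarrow> ('k tetrahedron \<Rightarrow> 'w \<Rightarrow> 'w) \<Rightarrow> bool"
  where "is_evaluation_module d a scaleW W act \<longleftrightarrow>
    1 \<le> d \<and> a \<noteq> 0 \<and> a \<noteq> 1 \<and>
    (\<exists>\<rho>. lie_module sl2_scale sl2_bracket scaleW W \<rho> \<and>
         irreducible_module scaleW W \<rho> \<and>
         vector_space.dim scaleW W = d + 1 \<and>
         (\<forall>\<xi>. \<forall>w\<in>W. act \<xi> w = \<rho> (EV a \<xi>) w))"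


section \<open>The Drinfel'd polynomial\<close>

definition eigenspace_on ::
  "('k::field \<Rightarrow> 'v::ab_group_add \<Rightarrow> 'v) \<Rightarrow> 'v set \<Rightarrow> ('v \<Rightarrow> 'v) \<Rightarrow> 'k \<Rightarrow> 'v set"
  where "eigenspace_on scaleV V T \<theta> = {v \<in> V. T v = scaleV \<theta> v}"

definition eigenvalues_on ::
  "('k::field \<Rightarrow> 'v::ab_group_add \<Rightarrow> 'v) \<Rightarrow> 'v set \<Rightarrow> ('v \<Rightarrow> 'v) \<Rightarrow> 'k set"
  where "eigenvalues_on scaleV V T = {\<theta>. \<exists>v\<in>eigenspace_on scaleV V T \<theta>. v \<noteq> 0}"

text \<open>Over an algebraically closed field, semisimple means diagonalizable.\<close>

definition semisimple_on ::
  "('k::field \<Rightarrow> 'v::ab_group_add \<Rightarrow> 'v) \<Rightarrow> 'v set \<Rightarrow> ('v \<Rightarrow> 'v) \<Rightarrow> bool"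
  where "semisimple_on scaleV V T \<longleftrightarrow>
    V = module.span scaleV (\<Union>\<theta>. eigenspace_on scaleV V T \<theta>)"

definition tet_diameter ::
  "('k::field \<Rightarrow> 'v::ab_group_add \<Rightarrow> 'v) \<Rightarrow> 'v set \<Rightarrow> ('k tetrahedron \<Rightarrow> 'v \<Rightarrow> 'v) \<Rightarrow> nat"
  where "tet_diameter scaleV V act = (THE d. \<forall>i j. i \<noteq> j \<longrightarrow>
    semisimple_on scaleV V (act (tet_x i j)) \<and>
    eigenvalues_on scaleV V (act (tet_x i j)) = {of_nat d - 2 * of_nat n | n. n \<le> d})"

definition tet_weight_space ::
  "('k::field \<Rightarrow> 'v::ab_group_add \<Rightarrow> 'v) \<Rightarrow> 'v set \<Rightarrow> ('k tetrahedron \<Rightarrow> 'v \<Rightarrow> 'v) \<Rightarrow> nat \<Rightarrow> 'v set"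
  where "tet_weight_space scaleV V act n =
    eigenspace_on scaleV V (act (tet_x I1 I3)) (2 * of_nat n - of_nat (tet_diameter scaleV V act))"

definition tet_e_plus :: "'k::field tetrahedron"
  where "tet_e_plus = tet_scale (1/2) (tet_x I1 I3 + tet_x I3 I0)"

definition tet_e_minus :: "'k::field tetrahedron"
  where "tet_e_minus = tet_scale (1/2) (tet_x I3 I1 + tet_x I1 I2)"

definition drinfeld_theta ::
  "('k::field \<Rightarrow> 'v::ab_group_add \<Rightarrow> 'v) \<Rightarrow> 'v set \<Rightarrow> ('k tetrahedron \<Rightarrow> 'v \<Rightarrow> 'v) \<Rightarrow> nat \<Rightarrow> 'k"
  where "drinfeld_theta scaleV V act i = (THE \<theta>. \<forall>v\<in>tet_weight_space scaleV V act 0.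
    (act tet_e_minus ^^ i) ((act tet_e_plus ^^ i) v) = scaleV \<theta> v)"

text \<open>\<open>Sum_any\<close> is the sum over all indices with nonzero summand (finitely many here).\<close>

definition drinfeld_poly ::
  "('k::field_char_0 \<Rightarrow> 'v::ab_group_add \<Rightarrow> 'v) \<Rightarrow> 'v set \<Rightarrow> ('k tetrahedron \<Rightarrow> 'v \<Rightarrow> 'v) \<Rightarrow> 'k poly"
  where "drinfeld_poly scaleV V act =
    Sum_any (\<lambda>i. monom ((-1) ^ i * drinfeld_theta scaleV V act i / (fact i)\<^sup>2) i)"

end

theory Submission
  imports Defs
begin

text \<open>
  For the equitable generators \<open>x\<^sub>i\<^sub>j, x\<^sub>j\<^sub>k, x\<^sub>k\<^sub>i\<close> the elements \<open>x\<^sub>i\<^sub>j\<close>,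
  \<open>x\<^sub>i\<^sub>j + x\<^sub>j\<^sub>k\<close> and \<open>-(x\<^sub>i\<^sub>j + x\<^sub>k\<^sub>i)/4\<close> form an \<open>sl\<^sub>2\<close>-triple, so every \<open>x\<^sub>i\<^sub>j\<close>
  acts on \<open>V\<^sub>d(a)\<close> diagonalizably with simple eigenvalues \<open>d - 2n\<close>. Hence a tensor product of
  evaluation modules has diameter \<open>d\<^sub>1 + \<dots> + d\<^sub>N\<close>, and \<open>V\<^sub>0\<close> is spanned by the tensor of the
  highest weight vectors. The map \<open>EV\<^sub>a\<close> sends \<open>e\<^sup>-\<close> to \<open>e\<close> and \<open>e\<^sup>+\<close> to \<open>a f\<close>. In terms of divided powers
  of \<open>f\<close>, expanding \<open>(e\<^sup>-)\<^sup>i (e\<^sup>+)\<^sup>i\<close> on the tensor product gives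
  \<open>\<vartheta>\<^sub>i = (i!)\<^sup>2 \<Sum> \<Prod>\<^sub>j (d\<^sub>j choose m\<^sub>j) a\<^sub>j\<^bsup>m\<^sub>j\<^esup>\<close>, the sum being over all \<open>m\<close> with \<open>m\<^sub>1 + \<dots> + m\<^sub>N = i\<close>, and
  up to the factor \<open>(-1)\<^sup>i (i!)\<^sup>2\<close> this is the coefficient of \<open>\<lambda>\<^sup>i\<close> in \<open>\<Prod>\<^sub>j (1 - a\<^sub>j \<lambda>)\<^bsup>d\<^sub>j\<^esup>\<close>.
\<close>

section \<open>Eigenvectors of an endomorphism of a subspace\<close>

text \<open>\<open>T\<close> is constrained only on \<open>M\<close>, because a module action is
  arbitrary outside its carrier.\<close>

locale subspace_endomorphism = vector_space scale
  for scale :: "'k::field \<Rightarrow> 'v::ab_group_add \<Rightarrow> 'v" +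
  fixes M :: "'v set" and T :: "'v \<Rightarrow> 'v"
  assumes subspace_M: "subspace M"
    and T_closed: "v \<in> M \<Longrightarrow> T v \<in> M"
    and T_add: "v \<in> M \<Longrightarrow> w \<in> M \<Longrightarrow> T (v + w) = T v + T w"
    and T_scale: "v \<in> M \<Longrightarrow> T (scale c v) = scale c (T v)"
begin

lemma T_zero: "T 0 = 0"
  using T_scale[of 0 0] subspace_0[OF subspace_M] by simp

lemma T_sum: "(\<And>i. i \<in> I \<Longrightarrow> f i \<in> M) \<Longrightarrow> T (\<Sum>i\<in>I. f i) = (\<Sum>i\<in>I. T (f i))"
proof (induction I rule: infinite_finite_induct)
  case (insert i I)
  then show ?case by (simp add: T_add subspace_sum[OF subspace_M])
qed (simp_all add: T_zero)

lemma funpow_closed: "v \<in> M \<Longrightarrow> (T ^^ n) v \<in> M"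
  by (induction n) (simp_all add: T_closed)

lemma funpow_scale: "v \<in> M \<Longrightarrow> (T ^^ n) (scale c v) = scale c ((T ^^ n) v)"
  by (induction n) (simp_all add: T_scale funpow_closed)

lemma funpow_sum_scale:
  assumes "\<And>i. i \<in> I \<Longrightarrow> f i \<in> M"
  shows "(T ^^ n) (\<Sum>i\<in>I. scale (c i) (f i)) = (\<Sum>i\<in>I. scale (c i) ((T ^^ n) (f i)))"
proof (induction n)
  case (Suc n)
  have "T (\<Sum>i\<in>I. scale (c i) ((T ^^ n) (f i))) = (\<Sum>i\<in>I. T (scale (c i) ((T ^^ n) (f i))))"
    using assms by (intro T_sum) (simp add: funpow_closed subspace_scale[OF subspace_M])
  also have "\<dots> = (\<Sum>i\<in>I. scale (c i) (T ((T ^^ n) (f i))))"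
    using assms by (intro sum.cong) (simp_all add: funpow_closed T_scale)
  finally show ?case using Suc by simp
qed simp

text \<open>Applying \<open>T - \<eta>\<close> to the relation removes the
  \<open>\<eta>\<close>-component and multiplies each other one by the nonzero scalar
  \<open>\<theta> - \<eta>\<close>, so induction on the set of eigenvalues applies.\<close>

lemma eigencomponents_zero:
  assumes "finite S"
    and "\<And>\<theta>. \<theta> \<in> S \<Longrightarrow> v \<theta> \<in> M \<and> T (v \<theta>) = scale \<theta> (v \<theta>)"
    and "(\<Sum>\<theta>\<in>S. v \<theta>) = 0"
  shows "\<forall>\<theta>\<in>S. v \<theta> = 0"
  using assms
proof (induction S arbitrary: v rule: finite_induct)
  case (insert \<eta> S)
  define w where "w \<theta> = scale (\<theta> - \<eta>) (v \<theta>)" for \<theta>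
  have w: "w \<theta> \<in> M \<and> T (w \<theta>) = scale \<theta> (w \<theta>)" if "\<theta> \<in> S" for \<theta>
    using insert.prems(1)[of \<theta>] that
    by (simp add: w_def T_scale subspace_scale[OF subspace_M] mult.commute)
  have "0 = T (\<Sum>\<theta>\<in>insert \<eta> S. v \<theta>) - scale \<eta> (\<Sum>\<theta>\<in>insert \<eta> S. v \<theta>)"
    using insert.prems(2) by (simp add: T_zero)
  also have "T (\<Sum>\<theta>\<in>insert \<eta> S. v \<theta>) = (\<Sum>\<theta>\<in>insert \<eta> S. scale \<theta> (v \<theta>))"
    using insert.prems(1) by (subst T_sum) auto
  also have "(\<Sum>\<theta>\<in>insert \<eta> S. scale \<theta> (v \<theta>)) - scale \<eta> (\<Sum>\<theta>\<in>insert \<eta> S. v \<theta>) = (\<Sum>\<theta>\<in>insert \<eta> S. w \<theta>)"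
    unfolding w_def by (simp only: scale_left_diff_distrib sum_subtractf scale_sum_right)
  also have "\<dots> = (\<Sum>\<theta>\<in>S. w \<theta>)"
    using insert.hyps by (simp add: w_def)
  finally have "(\<Sum>\<theta>\<in>S. w \<theta>) = 0" by (rule sym)
  with w have "\<forall>\<theta>\<in>S. w \<theta> = 0" by (rule insert.IH)
  then have S: "\<forall>\<theta>\<in>S. v \<theta> = 0"
    using insert.hyps by (auto simp: w_def)
  with insert show ?case by simp
qed simp

text \<open>Coefficients are indexed by \<open>I\<close> rather than by the image, so
  \<open>f\<close> may take a value more than once.\<close>

lemma span_image_sum:
  assumes "finite I" and "v \<in> span (f ` I)"
  obtains c where "v = (\<Sum>i\<in>I. scale (c i) (f i))"
proof -
  from assms have "\<exists>c. v = (\<Sum>i\<in>I. scale (c i) (f i))"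
  proof (induction I arbitrary: v rule: finite_induct)
    case (insert i I)
    then obtain k where "v - scale k (f i) \<in> span (f ` I)"
      by (auto simp: span_breakdown_eq)
    with insert.IH obtain c where c: "v - scale k (f i) = (\<Sum>j\<in>I. scale (c j) (f j))"
      by blast
    have "v = (\<Sum>j\<in>insert i I. scale ((c(i := k)) j) (f j))"
    proof -
      have "(\<Sum>j\<in>I. scale ((c(i := k)) j) (f j)) = (\<Sum>j\<in>I. scale (c j) (f j))"
        using insert.hyps by (intro sum.cong) auto
      then show ?thesis using c insert.hyps by (simp add: algebra_simps)
    qed
    then show ?case by blast
  qed simp
  then show ?thesis using that by blast
qed

text \<open>Grouping a linear combination by eigenvalue and subtracting \<open>v\<close> from the
  \<open>\<eta>\<close>-group leaves eigencomponents with sum zero; hence \<open>v\<close> equals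
  its \<open>\<eta>\<close>-group. Repeated values of \<open>\<theta>\<close> are allowed, as
  weights of a tensor product have multiplicities.\<close>

lemma eigenvector_in_span:
  assumes I: "finite I"
    and f: "\<And>i. i \<in> I \<Longrightarrow> f i \<in> M \<and> T (f i) = scale (\<theta> i) (f i)"
    and v: "v \<in> span (f ` I)" "T v = scale \<eta> v"
  shows "v \<in> span (f ` {i \<in> I. \<theta> i = \<eta>})"
proof -
  obtain c where c: "v = (\<Sum>i\<in>I. scale (c i) (f i))"
    using span_image_sum[OF I v(1)] .
  have vM: "v \<in> M"
    unfolding c using f by (auto intro!: subspace_sum[OF subspace_M] subspace_scale[OF subspace_M])
  \<comment> \<open>Including \<open>\<eta>\<close> covers the case where it is no
    \<open>\<theta> i\<close>: its group is then an empty sum and \<open>v\<close> is 0.\<close>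
  define S where "S = insert \<eta> (\<theta> ` I)"
  define g where "g \<zeta> = (\<Sum>i\<in>{i \<in> I. \<theta> i = \<zeta>}. scale (c i) (f i))" for \<zeta>
  define w where "w \<zeta> = g \<zeta> - (if \<zeta> = \<eta> then v else 0)" for \<zeta>
  have gM: "g \<zeta> \<in> M" for \<zeta>
    unfolding g_def using f by (auto intro!: subspace_sum[OF subspace_M] subspace_scale[OF subspace_M])
  have Tg: "T (g \<zeta>) = scale \<zeta> (g \<zeta>)" for \<zeta>
  proof -
    have "T (g \<zeta>) = (\<Sum>i\<in>{i \<in> I. \<theta> i = \<zeta>}. T (scale (c i) (f i)))"
      unfolding g_def using f by (intro T_sum) (auto intro!: subspace_scale[OF subspace_M])
    also have "\<dots> = (\<Sum>i\<in>{i \<in> I. \<theta> i = \<zeta>}. scale \<zeta> (scale (c i) (f i)))"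
      using f by (intro sum.cong) (auto simp: T_scale mult.commute)
    finally show ?thesis by (simp add: g_def scale_sum_right)
  qed
  have T_diff: "T (x - y) = T x - T y" if "x \<in> M" "y \<in> M" for x y
  proof -
    have "T (x + scale (-1) y) = T x + scale (-1) (T y)"
      unfolding T_scale[OF that(2), symmetric]
      using that by (intro T_add subspace_scale[OF subspace_M])
    then show ?thesis by simp
  qed
  have "\<forall>\<zeta>\<in>S. w \<zeta> = 0"
  proof (rule eigencomponents_zero)
    show "finite S" using I by (simp add: S_def)
    show "w \<zeta> \<in> M \<and> T (w \<zeta>) = scale \<zeta> (w \<zeta>)" if "\<zeta> \<in> S" for \<zeta>
      using gM Tg vM v(2)
      by (simp add: w_def T_diff subspace_diff[OF subspace_M] scale_right_diff_distrib)
    have "(\<Sum>\<zeta>\<in>S. g \<zeta>) = v"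
      unfolding g_def c using I by (intro sum.group) (auto simp: S_def)
    moreover have "(\<Sum>\<zeta>\<in>S. if \<zeta> = \<eta> then v else 0) = v"
      using I by (simp add: S_def)
    ultimately show "(\<Sum>\<zeta>\<in>S. w \<zeta>) = 0"
      by (simp add: w_def sum_subtractf)
  qed
  then have "v = g \<eta>" by (simp add: w_def S_def)
  then show ?thesis
    unfolding g_def by (auto intro!: span_sum span_scale intro: span_base)
qed

lemma eigenvectors_independent:
  assumes I: "finite I" "inj_on \<theta> I"
    and f: "\<And>i. i \<in> I \<Longrightarrow> f i \<in> M \<and> f i \<noteq> 0 \<and> T (f i) = scale (\<theta> i) (f i)"
  shows "inj_on f I" and "independent (f ` I)"
proof -
  show inj: "inj_on f I"
  proof (rule inj_onI)
    fix i j assume ij: "i \<in> I" "j \<in> I" "f i = f j"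
    then have "scale (\<theta> i) (f i) = scale (\<theta> j) (f i)" using f by metis
    then show "i = j" using f I ij by (auto dest: inj_onD)
  qed
  show "independent (f ` I)"
  proof (rule independent_if_scalars_zero)
    fix c x assume sum: "(\<Sum>x\<in>f ` I. scale (c x) x) = 0" and x: "x \<in> f ` I"
    then obtain i where i: "i \<in> I" "x = f i" by auto
    \<comment> \<open>The relation is reindexed by eigenvalue, which is possible because
      \<open>\<theta>\<close> is injective on \<open>I\<close>.\<close>
    define v where "v \<zeta> = scale (c (f (the_inv_into I \<theta> \<zeta>))) (f (the_inv_into I \<theta> \<zeta>))" for \<zeta>
    have v: "v (\<theta> j) = scale (c (f j)) (f j)" if "j \<in> I" for j
      using that I by (simp add: v_def the_inv_into_f_f)
    have "\<forall>\<zeta>\<in>\<theta> ` I. v \<zeta> = 0"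
    proof (rule eigencomponents_zero)
      show "v \<zeta> \<in> M \<and> T (v \<zeta>) = scale \<zeta> (v \<zeta>)" if "\<zeta> \<in> \<theta> ` I" for \<zeta>
        using that f v by (auto simp: T_scale subspace_scale[OF subspace_M] mult.commute)
      have "(\<Sum>\<zeta>\<in>\<theta> ` I. v \<zeta>) = (\<Sum>j\<in>I. scale (c (f j)) (f j))"
        using I by (simp add: sum.reindex v)
      also have "\<dots> = 0" using sum inj by (simp add: sum.reindex)
      finally show "(\<Sum>\<zeta>\<in>\<theta> ` I. v \<zeta>) = 0" .
    qed (use I in simp)
    then show "c x = 0" using i f v by fastforce
  qed (use I in simp)
qed

text \<open>This bound serves twice below: it forces chains of weight vectors to reach 0, and it
  bounds the length of such a chain by the dimension.\<close>

lemma eigenvectors_card_le: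
  assumes "finite I" "inj_on \<theta> I"
    and f: "\<And>i. i \<in> I \<Longrightarrow> f i \<in> M \<and> f i \<noteq> 0 \<and> T (f i) = scale (\<theta> i) (f i)"
    and B: "finite B" "M \<subseteq> span B"
  shows "card I \<le> card B"
proof -
  note ind = eigenvectors_independent[OF assms(1-3)]
  have "card (f ` I) \<le> card B"
    using independent_span_bound[OF B(1) ind(2)] B(2) f by blast
  then show ?thesis using ind(1) by (simp add: card_image)
qed

section \<open>Annihilating polynomials and existence of eigenvectors\<close>

lemma sum_degree_le:
  assumes "degree p \<le> n"
  shows "(\<Sum>i\<le>degree p. scale (coeff p i) (f i)) = (\<Sum>i\<le>n. scale (coeff p i) (f i))"
  using assms by (intro sum.mono_neutral_left) (auto simp: coeff_eq_0)

text \<open>The \<open>card B + 1\<close> iterates of \<open>v\<close> lie in the span of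
  \<open>B\<close>, so they satisfy a linear relation, whose coefficients form the
  polynomial.\<close>

lemma annihilating_poly_exists:
  assumes B: "finite B" "M \<subseteq> span B" and v: "v \<in> M"
  obtains p where "p \<noteq> 0" "(\<Sum>i\<le>degree p. scale (coeff p i) ((T ^^ i) v)) = 0"
proof -
  define f where "f i = (T ^^ i) v" for i
  define n where "n = card B"
  have fM: "f i \<in> span B" for i
    using B(2) v funpow_closed by (auto simp: f_def)
  have "\<exists>c. (\<exists>i\<le>n. c i \<noteq> 0) \<and> (\<Sum>i\<le>n. scale (c i) (f i)) = 0"
  proof (cases "inj_on f {..n}")
    case True
    have "dependent (f ` {..n})"
    proof (rule ccontr)
      assume "\<not> ?thesis"
      then have "card (f ` {..n}) \<le> card B"
        using independent_span_bound[OF B(1)] fM by blast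
      then show False using True by (simp add: card_image n_def)
    qed
    then obtain c where "\<exists>x\<in>f ` {..n}. c x \<noteq> 0" "(\<Sum>x\<in>f ` {..n}. scale (c x) x) = 0"
      by (auto simp: dependent_finite)
    then show ?thesis
      using True by (intro exI[of _ "c \<circ> f"]) (auto simp: sum.reindex)
  next
    \<comment> \<open>Repeated iterates collapse in the image set, which may then be independent;
      but \<open>f i = f j\<close> is itself a relation, with coefficients 1 and -1.\<close>
    case False
    then obtain i j where ij: "i \<le> n" "j \<le> n" "i \<noteq> j" "f i = f j"
      by (auto simp: inj_on_def)
    define c :: "nat \<Rightarrow> 'k" where "c k = (if k = i then 1 else 0) - (if k = j then 1 else 0)" for k
    have "(\<Sum>k\<le>n. scale (c k) (f k)) = (\<Sum>k\<le>n. (if k = i then f k else 0)) - (\<Sum>k\<le>n. (if k = j then f k else 0))"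
      unfolding sum_subtractf[symmetric] by (intro sum.cong) (auto simp: c_def)
    also have "\<dots> = 0" using ij by simp
    finally show ?thesis using ij by (intro exI[of _ c]) (auto simp: c_def)
  qed
  then obtain c i where c: "i \<le> n" "c i \<noteq> 0" "(\<Sum>i\<le>n. scale (c i) (f i)) = 0" by blast
  define p where "p = Abs_poly (\<lambda>i. if i \<le> n then c i else 0)"
  have p: "coeff p k = (if k \<le> n then c k else 0)" for k
    unfolding p_def
    by (subst coeff_Abs_poly[of n]) auto
  have "degree p \<le> n" by (rule degree_le) (simp add: p)
  then have "(\<Sum>i\<le>degree p. scale (coeff p i) (f i)) = 0"
    using c(3) unfolding sum_degree_le[OF \<open>degree p \<le> n\<close>] by (simp add: p cong: sum.cong_simp)
  moreover have "p \<noteq> 0" using c p[of i] by auto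
  ultimately show ?thesis using that by (simp add: f_def)
qed

end

text \<open>Among all nonzero \<open>p\<close> and nonzero \<open>v\<close> in \<open>M\<close> with
  \<open>p(T) v = 0\<close>, take \<open>p\<close> of least degree. With
  \<open>p = (X - c) q\<close>, minimality makes \<open>q(T) v\<close> nonzero, and
  \<open>T - c\<close> kills it.\<close>

lemma eigenvector_exists:
  fixes scale :: "'k::alg_closed_field \<Rightarrow> 'v::ab_group_add \<Rightarrow> 'v"
  assumes "subspace_endomorphism scale M T"
    and B: "finite B" "M \<subseteq> module.span scale B" and M: "M \<noteq> {0}"
  obtains v c where "v \<in> M" "v \<noteq> 0" "T v = scale c v"
proof -
  interpret subspace_endomorphism scale M T by fact
  define Q where "Q p v = (\<Sum>i\<le>degree p. scale (coeff p i) ((T ^^ i) v))" for p v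
  define good where "good n \<longleftrightarrow> (\<exists>p v. p \<noteq> 0 \<and> degree p = n \<and> v \<in> M \<and> v \<noteq> 0 \<and> Q p v = 0)" for n
  obtain v0 where v0: "v0 \<in> M" "v0 \<noteq> 0"
    using M subspace_0[OF subspace_M] by blast
  obtain p0 where "p0 \<noteq> 0" "Q p0 v0 = 0"
    using annihilating_poly_exists[OF B v0(1)] unfolding Q_def .
  then have "good (degree p0)" using v0 by (auto simp: good_def)
  then have "good (LEAST n. good n)" by (rule LeastI)
  then obtain p v where p: "p \<noteq> 0" "degree p = (LEAST n. good n)" "v \<in> M" "v \<noteq> 0" "Q p v = 0"
    by (auto simp: good_def)
  have "degree p > 0"
  proof (rule ccontr)
    assume "\<not> degree p > 0"
    then have "degree p = 0" by simp
    then obtain c where "p = [:c:]" by (rule degree_eq_zeroE)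
    then show False using p by (simp add: Q_def)
  qed
  then obtain c where "poly p c = 0"
    using alg_closed_imp_poly_has_root by blast
  then obtain q where q: "p = [:- c, 1:] * q"
    by (auto simp: poly_eq_0_iff_dvd elim: dvdE)
  have q0: "q \<noteq> 0" using p q by auto
  have deg: "degree p = Suc (degree q)"
    unfolding q using q0 by (subst degree_mult_eq) auto
  have QM: "Q q v \<in> M"
    unfolding Q_def using p
    by (auto intro!: subspace_sum[OF subspace_M] subspace_scale[OF subspace_M] funpow_closed)
  have Qq: "Q q v \<noteq> 0"
  proof
    assume "Q q v = 0"
    then have "good (degree q)" using q0 p by (auto simp: good_def)
    then have "(LEAST n. good n) \<le> degree q" by (rule Least_le)
    then show False using deg p by simp
  qed
  \<comment> \<open>Here \<open>p\<close> is \<open>X q - c q\<close>. The shifted polynomial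
    \<open>pCons 0 q\<close> contributes \<open>T (Q q v)\<close>; the extra top term of the sum for
    \<open>q\<close> has coefficient 0.\<close>
  have "Q p v = (\<Sum>i\<le>Suc (degree q). scale (coeff (pCons 0 q) i) ((T ^^ i) v)
      - scale c (scale (coeff q i) ((T ^^ i) v)))"
    unfolding Q_def deg by (intro sum.cong) (auto simp: q scale_left_diff_distrib)
  also have "\<dots> = (\<Sum>i\<le>Suc (degree q). scale (coeff (pCons 0 q) i) ((T ^^ i) v))
      - scale c (\<Sum>i\<le>Suc (degree q). scale (coeff q i) ((T ^^ i) v))"
    by (simp only: sum_subtractf scale_sum_right)
  also have "(\<Sum>i\<le>Suc (degree q). scale (coeff q i) ((T ^^ i) v)) = Q q v"
    unfolding Q_def by (rule sum_degree_le[symmetric]) simp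
  also have "(\<Sum>i\<le>Suc (degree q). scale (coeff (pCons 0 q) i) ((T ^^ i) v)) = T (Q q v)"
    unfolding Q_def sum.atMost_Suc_shift using p
    by (subst T_sum) (simp_all add: T_scale funpow_closed subspace_scale[OF subspace_M])
  finally have "T (Q q v) = scale c (Q q v)" using p by simp
  then show ?thesis using that QM Qq by blast
qed

section \<open>Irreducible modules over an \<open>sl\<^sub>2\<close>-triple\<close>

lemma (in lie_module) subspace_endomorphism_act: "subspace_endomorphism scaleV M (act \<xi>)"
  by unfold_locales (simp_all add: subspace_carrier act_closed act_add_right act_scale_right)

lemma (in lie_module) act_minus_left: "v \<in> M \<Longrightarrow> act (- \<xi>) v = - act \<xi> v"
  using act_scale_left[of v "-1" \<xi>] by simp

text \<open>The vectors \<open>u n\<close> are the divided powers \<open>f\<^sup>n v / n!\<close> applied to a highest weight vector \<open>v\<close>.\<close>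

lemma sl2_triple_irreducible_basis:
  fixes scaleV :: "'k::{alg_closed_field, field_char_0} \<Rightarrow> 'v::ab_group_add \<Rightarrow> 'v"
  assumes "lie_module scaleL br scaleV M act"
    and he: "br h e = scaleL 2 e" and hf: "br h f = scaleL (-2) f" and ef: "br e f = h"
    and irr: "\<And>U. module.subspace scaleV U \<Longrightarrow> U \<subseteq> M \<Longrightarrow>
      (\<And>u. u \<in> U \<Longrightarrow> act e u \<in> U \<and> act f u \<in> U \<and> act h u \<in> U) \<Longrightarrow> U = {0} \<or> U = M"
    and dim: "vector_space.dim scaleV M = d + 1"
  obtains u :: "nat \<Rightarrow> 'v" where
    "M = module.span scaleV (u ` {..d})"
    "\<And>n. n \<le> d \<Longrightarrow> u n \<noteq> 0" "\<And>n. n > d \<Longrightarrow> u n = 0"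
    "\<And>n. act h (u n) = scaleV (of_nat d - 2 * of_nat n) (u n)"
    "\<And>n. act f (u n) = scaleV (of_nat (Suc n)) (u (Suc n))"
    "act e (u 0) = 0"
    "\<And>n. act e (u (Suc n)) = scaleV (of_nat d - of_nat n) (u n)"
proof -
  interpret lie_module scaleL br scaleV M act by fact
  interpret H: subspace_endomorphism scaleV M "act h" by (rule subspace_endomorphism_act)
  interpret E: subspace_endomorphism scaleV M "act e" by (rule subspace_endomorphism_act)
  interpret F: subspace_endomorphism scaleV M "act f" by (rule subspace_endomorphism_act)
  note sc = V.subspace_scale[OF subspace_carrier]
  obtain B where B: "B \<subseteq> M" "V.independent B" "M \<subseteq> V.span B" "card B = d + 1"
    using V.basis_exists[of M] dim by auto
  \<comment> \<open>An infinite set would have cardinality 0.\<close>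
  have finB: "finite B" using B(4) by (intro card_ge_0_finite) simp
  have M0: "M \<noteq> {0}"
  proof
    assume "M = {0}"
    then have "V.dim M \<le> card ({} :: 'v set)" by (intro V.dim_le_card) auto
    then show False using dim by simp
  qed
  obtain v0 c0 where v0: "v0 \<in> M" "v0 \<noteq> 0" "act h v0 = scaleV c0 v0"
    using eigenvector_exists[OF subspace_endomorphism_act finB B(3) M0] .
  have HE: "act h (act e v) = act e (act h v) + scaleV 2 (act e v)" if "v \<in> M" for v
    using act_bracket[of v h e] act_scale_left[of v 2 e] that he by (simp add: algebra_simps)
  have HF: "act h (act f v) = act f (act h v) + scaleV (-2) (act f v)" if "v \<in> M" for v
    using act_bracket[of v h f] act_scale_left[of v "-2" f] that hf by (simp add: algebra_simps)
  have EF: "act e (act f v) = act f (act e v) + act h v" if "v \<in> M" for v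
    using act_bracket[of v e f] that ef by (simp add: algebra_simps)
  \<comment> \<open>Each application of \<open>e\<close> raises the \<open>h\<close>-eigenvalue by
    2. Since \<open>M\<close> cannot hold \<open>d + 2\<close> distinct eigenvalues, the chain
    reaches 0, and its last nonzero vector is a highest weight vector.\<close>
  define w where "w n = (act e ^^ n) v0" for n
  have wM: "w n \<in> M" for n by (simp add: w_def E.funpow_closed v0)
  have Hw: "act h (w n) = scaleV (c0 + 2 * of_nat n) (w n)" for n
  proof (induction n)
    case (Suc n)
    have "w (Suc n) = act e (w n)" by (simp add: w_def)
    then show ?case
      using Suc wM[of n]
      by (simp add: HE E.T_scale algebra_simps flip: V.scale_left_distrib)
  qed (simp add: w_def v0)
  have "\<exists>n. w n = 0"
  proof (rule ccontr)
    assume "\<not> ?thesis"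
    then have "card {..d + 1} \<le> card B"
      using finB B(3) wM Hw
      by (intro H.eigenvectors_card_le[where f = w and \<theta> = "\<lambda>n. c0 + 2 * of_nat n"])
        (auto intro!: inj_onI)
    then show False using B by simp
  qed
  then obtain n0 where n0: "w n0 = 0" "\<And>n. n < n0 \<Longrightarrow> w n \<noteq> 0"
    using exists_least_iff[of "\<lambda>n. w n = 0"] by blast
  have "n0 \<noteq> 0" using n0(1) v0 by (cases n0) (auto simp: w_def)
  then obtain m0 where m0: "n0 = Suc m0" by (cases n0) auto
  define v where "v = w m0"
  define c where "c = c0 + 2 * of_nat m0"
  have v: "v \<in> M" "v \<noteq> 0" "act e v = 0" "act h v = scaleV c v"
    using n0 m0 wM Hw by (auto simp: v_def c_def w_def)
  define u where "u n = scaleV (inverse (fact n)) ((act f ^^ n) v)" for n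
  have uM: "u n \<in> M" for n by (simp add: u_def sc F.funpow_closed v)
  have Fu: "act f (u n) = scaleV (of_nat (Suc n)) (u (Suc n))" for n
  proof -
    have "inverse (fact n) = of_nat (Suc n) * (inverse (fact (Suc n)) :: 'k)"
      by (simp add: field_simps del: of_nat_Suc)
    then show ?thesis by (simp add: u_def F.T_scale F.funpow_closed v del: of_nat_Suc fact_Suc)
  qed
  have u_Suc: "u (Suc n) = scaleV (inverse (of_nat (Suc n))) (act f (u n))" for n
    unfolding Fu by (simp del: of_nat_Suc)
  have Hu: "act h (u n) = scaleV (c - 2 * of_nat n) (u n)" for n
  proof (induction n)
    case (Suc n)
    have "act h (act f (u n)) = scaleV (c - 2 * of_nat (Suc n)) (act f (u n))"
      using Suc uM[of n]
      by (simp add: HF F.T_scale algebra_simps flip: V.scale_left_distrib V.scale_left_diff_distrib)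
    then show ?case
      unfolding u_Suc[of n] using uM[of n] by (simp add: H.T_scale F.T_closed mult.commute del: of_nat_Suc)
  qed (simp add: u_def v)
  have Eu0: "act e (u 0) = 0" by (simp add: u_def v)
  \<comment> \<open>The induction uses \<open>ef = fe + h\<close> and the identity
    \<open>(c - n)(n + 1) + c - 2(n + 1) = (n + 2)(c - n - 1)\<close>.\<close>
  have EFu: "act e (act f (u n)) = scaleV (of_nat (Suc n) * (c - of_nat n)) (u n)"
    and Eu: "act e (u (Suc n)) = scaleV (c - of_nat n) (u n)" for n
  proof (induction n)
    case 0
    show 1: "act e (act f (u 0)) = scaleV (of_nat (Suc 0) * (c - of_nat 0)) (u 0)"
      using uM Hu[of 0] by (simp add: EF Eu0 F.T_zero)
    show "act e (u (Suc 0)) = scaleV (c - of_nat 0) (u 0)"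
      using 1 uM by (simp add: u_Suc)
  next
    case (Suc n)
    have "act e (act f (u (Suc n))) = act f (act e (u (Suc n))) + act h (u (Suc n))"
      using uM by (simp add: EF)
    also have "act f (act e (u (Suc n))) = scaleV ((c - of_nat n) * of_nat (Suc n)) (u (Suc n))"
      using uM by (simp add: Suc(2) F.T_scale Fu del: of_nat_Suc)
    also have "act h (u (Suc n)) = scaleV (c - 2 * of_nat (Suc n)) (u (Suc n))" by (rule Hu)
    finally show 1: "act e (act f (u (Suc n))) = scaleV (of_nat (Suc (Suc n)) * (c - of_nat (Suc n))) (u (Suc n))"
      by (simp add: algebra_simps flip: V.scale_left_distrib)
    show "act e (u (Suc (Suc n))) = scaleV (c - of_nat (Suc n)) (u (Suc n))"
      unfolding u_Suc[of "Suc n"] using 1 uM by (simp add: E.T_scale F.T_closed del: of_nat_Suc)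
  qed
  have "\<exists>n. u n = 0"
  proof (rule ccontr)
    assume "\<not> ?thesis"
    then have "card {..d + 1} \<le> card B"
      using finB B(3) uM Hu
      by (intro H.eigenvectors_card_le[where f = u and \<theta> = "\<lambda>n. c - 2 * of_nat n"])
        (auto intro!: inj_onI)
    then show False using B by simp
  qed
  then obtain k where k: "u k = 0" "\<And>n. n < k \<Longrightarrow> u n \<noteq> 0"
    using exists_least_iff[of "\<lambda>n. u n = 0"] by blast
  have "k \<noteq> 0" using k(1) v by (cases k) (auto simp: u_def)
  then obtain n where n: "k = Suc n" by (cases k) auto
  have un: "u i \<noteq> 0" if "i \<le> n" for i using k n that by simp
  have u0: "u i = 0" if "i > n" for i
    using that
  proof (induction i rule: less_induct)
    case (less i)
    then obtain j where j: "i = Suc j" by (cases i) auto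
    show ?case
    proof (cases "j = n")
      case True
      then show ?thesis using k n j by simp
    next
      case False
      then have "u j = 0" using less j by simp
      then show ?thesis by (simp add: j u_Suc F.T_zero)
    qed
  qed
  \<comment> \<open>Since \<open>u (Suc n) = 0\<close>, also \<open>0 = (c - n) u n\<close>, while
    \<open>u n\<close> is nonzero.\<close>
  have cn: "c = of_nat n"
    using Eu[of n] un[of n] k n by (simp add: E.T_zero)
  \<comment> \<open>The span of the chain is a nonzero invariant subspace, hence all of
    \<open>M\<close>. Counting spanning vectors gives \<open>d \<le> n\<close>, and counting
    distinct eigenvalues gives \<open>n \<le> d\<close>.\<close>
  define U where "U = V.span (u ` {..n})"
  have uU: "u i \<in> U" for i
    unfolding U_def by (cases "i \<le> n") (auto simp: u0 V.span_zero intro: V.span_base)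
  have UM: "U \<subseteq> M"
    unfolding U_def using uM subspace_carrier by (intro V.span_minimal) auto
  have subU: "V.subspace U" by (simp add: U_def)
  have inv: "act \<xi> x \<in> U" if "\<And>i. act \<xi> (u i) \<in> U" "x \<in> U" for \<xi> x
  proof -
    interpret X: subspace_endomorphism scaleV M "act \<xi>" by (rule subspace_endomorphism_act)
    obtain b where "x = (\<Sum>i\<le>n. scaleV (b i) (u i))"
      using X.span_image_sum[of "{..n}" x u] \<open>x \<in> U\<close> unfolding U_def by auto
    then have "act \<xi> x = (\<Sum>i\<le>n. scaleV (b i) (act \<xi> (u i)))"
      using X.funpow_sum_scale[of "{..n}" u 1 b] uM by simp
    then show ?thesis
      using that by (auto intro!: V.subspace_sum[OF subU] V.subspace_scale[OF subU])
  qed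
  have "U = {0} \<or> U = M"
  proof (rule irr[OF subU UM], intro conjI)
    fix x assume x: "x \<in> U"
    show "act e x \<in> U"
    proof (rule inv[OF _ x])
      show "act e (u i) \<in> U" for i
        by (cases i) (auto simp: Eu0 Eu V.subspace_0[OF subU] intro!: V.subspace_scale[OF subU] uU)
    qed
    show "act f x \<in> U"
      by (rule inv[OF _ x], unfold Fu) (intro V.subspace_scale[OF subU] uU)
    show "act h x \<in> U"
      by (rule inv[OF _ x], unfold Hu) (intro V.subspace_scale[OF subU] uU)
  qed
  then have MU: "M = U" using uU[of 0] un[of 0] by auto
  have "d + 1 \<le> card (u ` {..n})"
    unfolding dim[symmetric] by (rule V.dim_le_card) (simp_all add: MU U_def)
  also have "\<dots> \<le> n + 1" using card_image_le[of "{..n}" u] by simp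
  finally have "d \<le> n" by simp
  moreover have "card {..n} \<le> card B"
    using finB B(3) uM Hu un
    by (intro H.eigenvectors_card_le[where f = u and \<theta> = "\<lambda>n. c - 2 * of_nat n"])
      (auto intro!: inj_onI)
  then have "n \<le> d" using B by simp
  ultimately have nd: "n = d" by simp
  show ?thesis
  proof
    show "M = V.span (u ` {..d})" by (simp only: MU U_def nd)
  qed (use un u0 Hu Fu Eu0 Eu in \<open>simp_all only: nd cn simp_thms\<close>)
qed

section \<open>Tensor products\<close>

lemma lookup_free_scale: "Poly_Mapping.lookup (free_scale c p) x = c * Poly_Mapping.lookup p x"
  by (simp add: free_scale_def map.rep_eq when_def)

interpretation free: vector_space free_scale
  by unfold_locales (auto intro!: poly_mapping_eqI simp: lookup_free_scale lookup_add algebra_simps)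

context vector_space
begin

lemma free_extend_superset:
  assumes "finite A" "Poly_Mapping.keys p \<subseteq> A"
  shows "free_extend scale \<tau> p = (\<Sum>x\<in>A. scale (Poly_Mapping.lookup p x) (\<tau> x))"
  unfolding free_extend_def using assms
  by (intro sum.mono_neutral_left) (auto simp: in_keys_iff)

lemma free_extend_single: "free_extend scale \<tau> (Poly_Mapping.single x c) = scale c (\<tau> x)"
  by (subst free_extend_superset[of "{x}"]) auto

lemma linear_free_extend: "Vector_Spaces.linear free_scale scale (free_extend scale \<tau>)"
proof unfold_locales
  fix p q :: "'c \<Rightarrow>\<^sub>0 'a" and c
  let ?A = "Poly_Mapping.keys p \<union> Poly_Mapping.keys q"
  have "free_extend scale \<tau> (p + q) = (\<Sum>x\<in>?A. scale (Poly_Mapping.lookup (p + q) x) (\<tau> x))"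
    by (rule free_extend_superset) (use Poly_Mapping.keys_add[of p q] in auto)
  also have "\<dots> = free_extend scale \<tau> p + free_extend scale \<tau> q"
    by (simp add: free_extend_superset[of ?A] lookup_add scale_left_distrib sum.distrib)
  finally show "free_extend scale \<tau> (p + q) = free_extend scale \<tau> p + free_extend scale \<tau> q" .
  have "free_extend scale \<tau> (free_scale c p)
      = (\<Sum>x\<in>Poly_Mapping.keys p. scale (Poly_Mapping.lookup (free_scale c p) x) (\<tau> x))"
    by (rule free_extend_superset) (auto simp: in_keys_iff lookup_free_scale)
  then show "free_extend scale \<tau> (free_scale c p) = scale c (free_extend scale \<tau> p)"
    by (simp add: free_extend_def lookup_free_scale scale_sum_right)
qed

text \<open>Such functionals are the factors of the multilinear form that detects nonzero pure
  tensors.\<close>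

lemma functional_exists:
  assumes "x \<noteq> 0"
  obtains \<phi> where "Vector_Spaces.linear scale (*) \<phi>" "\<phi> x = 1"
proof -
  interpret vector_space_pair scale "(*) :: 'a \<Rightarrow> 'a \<Rightarrow> 'a"
    by (intro vector_space_pair.intro vector_space_axioms) (unfold_locales; simp add: algebra_simps)
  have "independent {x}" using assms by simp
  from linear_independent_extend[OF this, of "\<lambda>_. 1"] show ?thesis using that by auto
qed

end

text \<open>The conditions on \<open>scaleW\<close> are conditional on \<open>j \<in> I\<close>
  because they are later read off from the factors, and an empty product has none.\<close>

locale tensor_product = V: vector_space scaleV
  for scaleV :: "'k::field \<Rightarrow> 'v::ab_group_add \<Rightarrow> 'v" +
  fixes I :: "'i set" and scaleW :: "'k \<Rightarrow> 'w::ab_group_add \<Rightarrow> 'w" and W :: "'i \<Rightarrow> 'w set"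
    and V :: "'v set" and \<tau> :: "('i \<Rightarrow> 'w) \<Rightarrow> 'v"
  assumes finite_I: "finite I"
    and vector_space_W: "j \<in> I \<Longrightarrow> vector_space scaleW"
    and subspace_W: "j \<in> I \<Longrightarrow> module.subspace scaleW (W j)"
    and subspace_V: "V.subspace V"
    and tensor: "is_tensor_product I scaleW W scaleV V \<tau>"
begin

lemma relator_zero: "p \<in> multilinear_relators I scaleW W \<Longrightarrow> free_extend scaleV \<tau> p = 0"
  using tensor free.span_base[of p] by (auto simp: is_tensor_product_def)

lemma tensor_add:
  assumes "u \<in> Pi\<^sub>E I W" "j \<in> I" "x \<in> W j" "y \<in> W j"
  shows "\<tau> (u(j := x + y)) = \<tau> (u(j := x)) + \<tau> (u(j := y))"
proof -
  interpret L: Vector_Spaces.linear free_scale scaleV "free_extend scaleV \<tau>"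
    by (rule V.linear_free_extend)
  have "free_extend scaleV \<tau> (Poly_Mapping.single (u(j := x + y)) 1
      - Poly_Mapping.single (u(j := x)) 1 - Poly_Mapping.single (u(j := y)) 1) = 0"
    using assms by (intro relator_zero) (auto simp: multilinear_relators_def)
  then show ?thesis
    by (simp add: L.diff L.add V.free_extend_single diff_diff_eq)
qed

lemma tensor_scale:
  assumes "u \<in> Pi\<^sub>E I W" "j \<in> I" "x \<in> W j"
  shows "\<tau> (u(j := scaleW c x)) = scaleV c (\<tau> (u(j := x)))"
proof -
  interpret L: Vector_Spaces.linear free_scale scaleV "free_extend scaleV \<tau>"
    by (rule V.linear_free_extend)
  have "free_extend scaleV \<tau> (Poly_Mapping.single (u(j := scaleW c x)) 1
      - free_scale c (Poly_Mapping.single (u(j := x)) 1)) = 0"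
    using assms by (intro relator_zero) (unfold multilinear_relators_def, blast)
  then show ?thesis
    by (simp add: L.diff L.scale V.free_extend_single)
qed

lemma tensor_in_V:
  assumes "u \<in> Pi\<^sub>E I W"
  shows "\<tau> u \<in> V"
proof -
  have "free_extend scaleV \<tau> (Poly_Mapping.single u 1) \<in> V"
    using tensor assms unfolding is_tensor_product_def by (auto simp del: free_extend_def)
  then show ?thesis by (simp add: V.free_extend_single)
qed

text \<open>A product of linear functionals on the factors kills the relators, so it factors through \<open>\<tau>\<close>.\<close>

lemma tensor_nonzero:
  assumes u: "u \<in> Pi\<^sub>E I W" and nz: "\<And>j. j \<in> I \<Longrightarrow> u j \<noteq> 0"
  shows "\<tau> u \<noteq> 0"
proof
  assume \<tau>: "\<tau> u = 0"
  have "\<exists>\<phi>. Vector_Spaces.linear scaleW (*) \<phi> \<and> \<phi> (u j) = 1" if "j \<in> I" for j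
    using vector_space.functional_exists[OF vector_space_W[OF that] nz[OF that]] by metis
  then obtain \<phi> where lin: "\<And>j. j \<in> I \<Longrightarrow> Vector_Spaces.linear scaleW (*) (\<phi> j)"
    and one: "\<And>j. j \<in> I \<Longrightarrow> \<phi> j (u j) = 1"
    by metis
  have K: "vector_space ((*) :: 'k \<Rightarrow> 'k \<Rightarrow> 'k)"
    by unfold_locales (simp_all add: algebra_simps)
  define \<beta> where "\<beta> w = (\<Prod>j\<in>I. \<phi> j (w j))" for w
  define \<psi> where "\<psi> = free_extend (*) \<beta>"
  interpret \<psi>: Vector_Spaces.linear free_scale "(*)" \<psi>
    unfolding \<psi>_def by (rule vector_space.linear_free_extend[OF K])
  \<comment> \<open>This isolates the dependence on slot \<open>j\<close>, so linearity of
    \<open>\<phi> j\<close> makes \<open>\<psi>\<close> vanish on both kinds of relators.\<close>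
  have upd: "\<beta> (w(j := x)) = \<phi> j x * (\<Prod>k\<in>I - {j}. \<phi> k (w k))" if "j \<in> I" for w j x
    unfolding \<beta>_def using finite_I that
    by (subst prod.remove[of I j]) (auto intro!: prod.cong arg_cong2[where f = "(*)"])
  have "free.subspace {p. \<psi> p = 0}"
    by (rule free.subspaceI) (simp_all add: \<psi>.zero \<psi>.add \<psi>.scale)
  moreover have "multilinear_relators I scaleW W \<subseteq> {p. \<psi> p = 0}"
  proof
    fix p assume "p \<in> multilinear_relators I scaleW W"
    then consider w j x y where "j \<in> I" "p = Poly_Mapping.single (w(j := x + y)) 1
         - Poly_Mapping.single (w(j := x)) 1 - Poly_Mapping.single (w(j := y)) 1"
      | w j c x where "j \<in> I" "p = Poly_Mapping.single (w(j := scaleW c x)) 1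
         - free_scale c (Poly_Mapping.single (w(j := x)) 1)"
      unfolding multilinear_relators_def by blast
    then show "p \<in> {p. \<psi> p = 0}"
    proof cases
      case 1
      interpret \<phi>: Vector_Spaces.linear scaleW "(*)" "\<phi> j" using lin[OF 1(1)] .
      show ?thesis
        using 1 by (simp add: \<psi>.diff) (simp add: \<psi>_def vector_space.free_extend_single[OF K] upd \<phi>.add algebra_simps)
    next
      case 2
      interpret \<phi>: Vector_Spaces.linear scaleW "(*)" "\<phi> j" using lin[OF 2(1)] .
      show ?thesis
        using 2 by (simp add: \<psi>.diff \<psi>.scale) (simp add: \<psi>_def vector_space.free_extend_single[OF K] upd \<phi>.scale)
    qed
  qed
  ultimately have "free.span (multilinear_relators I scaleW W) \<subseteq> {p. \<psi> p = 0}"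
    by (intro free.span_minimal)
  \<comment> \<open>If \<open>\<tau> u = 0\<close>, the basis vector of \<open>u\<close> lies in the
    kernel and hence in the span of the relators, where \<open>\<psi>\<close> vanishes; yet
    \<open>\<psi>\<close> takes the value 1 there.\<close>
  moreover have "Poly_Mapping.single u 1 \<in> free.span (multilinear_relators I scaleW W)"
  proof -
    have "Poly_Mapping.single u 1 \<in> {p. Poly_Mapping.keys p \<subseteq> Pi\<^sub>E I W \<and> free_extend scaleV \<tau> p = 0}"
      using u \<tau> by (simp add: V.free_extend_single)
    then show ?thesis using tensor unfolding is_tensor_product_def by blast
  qed
  ultimately have "\<psi> (Poly_Mapping.single u 1) = 0" by blast
  then show False
    by (simp add: \<psi>_def vector_space.free_extend_single[OF K] \<beta>_def one)
qed

text \<open>Slots are treated one at a time: for fixed other entries, the vectors whose tensor lies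
  in the span form a subspace of \<open>W j\<close> that contains \<open>B j\<close>.\<close>

lemma tensor_basis_span:
  assumes B: "\<And>j. j \<in> I \<Longrightarrow> W j = module.span scaleW (B j)"
  shows "V = V.span (\<tau> ` Pi\<^sub>E I B)"
proof
  have BW: "B j \<subseteq> W j" if "j \<in> I" for j
  proof -
    interpret W: vector_space scaleW using vector_space_W[OF that] .
    show ?thesis using B[OF that] W.span_superset by auto
  qed
  then have "\<tau> ` Pi\<^sub>E I B \<subseteq> V"
    using tensor_in_V by (fastforce simp: PiE_iff)
  then show "V.span (\<tau> ` Pi\<^sub>E I B) \<subseteq> V"
    using subspace_V by (intro V.span_minimal)
  \<comment> \<open>\<open>J\<close> holds the slots whose entries are still arbitrary; the case
    \<open>J = I\<close> is the one wanted.\<close>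
  have *: "\<tau> u \<in> V.span (\<tau> ` Pi\<^sub>E I B)"
    if "J \<subseteq> I" "u \<in> Pi\<^sub>E I W" "\<And>k. k \<in> I - J \<Longrightarrow> u k \<in> B k" for J u
    using finite_subset[OF that(1) finite_I] that
  proof (induction J arbitrary: u rule: finite_induct)
    case empty
    then have "u \<in> Pi\<^sub>E I B" by (auto simp: PiE_iff)
    then show ?case by (intro V.span_base) auto
  next
    case (insert j J)
    then have j: "j \<in> I" by auto
    interpret W: vector_space scaleW using vector_space_W[OF j] .
    note sW = subspace_W[OF j]
    let ?S = "{x \<in> W j. \<tau> (u(j := x)) \<in> V.span (\<tau> ` Pi\<^sub>E I B)}"
    have "W.subspace ?S"
    proof (rule W.subspaceI)
      have "\<tau> (u(j := scaleW 0 0)) = scaleV 0 (\<tau> (u(j := 0)))"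
        using insert.prems j W.subspace_0[OF sW] by (intro tensor_scale)
      then show "0 \<in> ?S"
        using W.subspace_0[OF sW] by (simp add: V.span_zero)
      show "x + y \<in> ?S" if "x \<in> ?S" "y \<in> ?S" for x y
        using that insert.prems j by (auto simp: tensor_add W.subspace_add[OF sW] V.span_add)
      show "scaleW c x \<in> ?S" if "x \<in> ?S" for c x
        using that insert.prems j by (auto simp: tensor_scale W.subspace_scale[OF sW] V.span_scale)
    qed
    moreover have "B j \<subseteq> ?S"
    proof
      fix b assume b: "b \<in> B j"
      have "\<tau> (u(j := b)) \<in> V.span (\<tau> ` Pi\<^sub>E I B)"
        using insert.prems j b BW[OF j] by (intro insert.IH) (auto simp: PiE_iff extensional_def)
      then show "b \<in> ?S" using b BW[OF j] by auto
    qed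
    ultimately have "W j \<subseteq> ?S"
      unfolding B[OF j] by (intro W.span_minimal) (simp_all add: B[OF j, symmetric])
    then have "u j \<in> ?S" using insert.prems j by auto
    then show ?case by simp
  qed
  show "V \<subseteq> V.span (\<tau> ` Pi\<^sub>E I B)"
  proof
    fix v assume "v \<in> V"
    then obtain p where p: "Poly_Mapping.keys p \<subseteq> Pi\<^sub>E I W" "v = free_extend scaleV \<tau> p"
      using tensor unfolding is_tensor_product_def by blast
    then show "v \<in> V.span (\<tau> ` Pi\<^sub>E I B)"
      unfolding free_extend_def by (auto intro!: V.span_sum V.span_scale *[of I])
  qed
qed

end

section \<open>Weight bases of evaluation modules\<close>

context lie_algebra
begin

lemma bracket_antisym: "bracket x y = - bracket y x"
proof -
  have "bracket x x + bracket y x + (bracket x y + bracket y y) = 0"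
    using bracket_self[of "x + y"] by (simp only: bracket_add_left bracket_add_right)
  then show ?thesis by (simp add: bracket_self eq_neg_iff_add_eq_0 add.commute)
qed

lemma bracket_zero_left: "bracket 0 x = 0"
  using bracket_scale_left[of 0 0 x] by simp

end

text \<open>The factor \<open>-1/4\<close> comes from \<open>[X + Y, X + Z] = -4 X\<close>. The
  hypotheses are the relations (ii) for a cyclic triple of indices, so every \<open>x_ij\<close>
  becomes the semisimple member of such a triple.\<close>

lemma (in lie_algebra) sl2_triple_of_equitable:
  fixes X Y Z :: 'l
  assumes XY: "bracket X Y = scaleL 2 X + scaleL 2 Y"
    and YZ: "bracket Y Z = scaleL 2 Y + scaleL 2 Z"
    and ZX: "bracket Z X = scaleL 2 Z + scaleL 2 X"
    and four: "(4 :: 'k) \<noteq> 0"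
  shows "bracket X (X + Y) = scaleL 2 (X + Y)"
    and "bracket X (scaleL (- 1 / 4) (X + Z)) = scaleL (-2) (scaleL (- 1 / 4) (X + Z))"
    and "bracket (X + Y) (scaleL (- 1 / 4) (X + Z)) = X"
proof -
  have XZ: "bracket X Z = - (scaleL 2 Z + scaleL 2 X)"
    and YX: "bracket Y X = - (scaleL 2 X + scaleL 2 Y)"
    using bracket_antisym[of X Z] bracket_antisym[of Y X] ZX XY by simp_all
  show "bracket X (X + Y) = scaleL 2 (X + Y)"
    by (simp add: bracket_add_right bracket_self XY scale_right_distrib)
  have "bracket X (X + Z) = scaleL (-2) (X + Z)"
    by (simp add: bracket_add_right bracket_self XZ scale_right_distrib)
  then show "bracket X (scaleL (- 1 / 4) (X + Z)) = scaleL (-2) (scaleL (- 1 / 4) (X + Z))"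
    by (simp only: bracket_scale_right scale_scale mult.commute)
  have "bracket (X + Y) (X + Z) = - (scaleL 2 X + scaleL 2 X)"
    by (simp add: bracket_add_left bracket_add_right bracket_self XY YZ XZ YX)
  also have "\<dots> = scaleL (-4) X"
    by (simp flip: scale_left_distrib)
  finally have "bracket (X + Y) (X + Z) = scaleL (-4) X" .
  then have "bracket (X + Y) (scaleL (- 1 / 4) (X + Z)) = scaleL (- 1 / 4) (scaleL (-4) X)"
    by (simp only: bracket_scale_right)
  then show "bracket (X + Y) (scaleL (- 1 / 4) (X + Z)) = X"
    using four by simp
qed

section \<open>Triples that span \<open>sl2\<close>\<close>

lemma sl2_standard_span: "sl2.span {sl2_e, sl2_f, sl2_h :: 'k::field sl2} = UNIV"
proof -
  have "A \<in> sl2.span {sl2_e, sl2_f, sl2_h}" for A :: "'k sl2"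
  proof -
    have A: "A = sl2_scale (Rep_sl2 A $ 1 $ 2) sl2_e + sl2_scale (Rep_sl2 A $ 2 $ 1) sl2_f
        + sl2_scale (Rep_sl2 A $ 1 $ 1) sl2_h"
      by (simp add: sl2_eq_iff sl2_entries)
    show ?thesis
      by (subst A) (intro sl2.span_add sl2.span_scale sl2.span_base; simp)
  qed
  then show ?thesis by blast
qed

text \<open>The three elements are eigenvectors of \<open>ad h\<close> for 2, -2 and 0, nonzero
  because \<open>[e, f] = h\<close> is. They are thus independent, in a space spanned by three
  elements.\<close>

lemma sl2_triple_span:
  fixes e f h :: "'k::field_char_0 sl2"
  assumes he: "sl2_bracket h e = sl2_scale 2 e" and hf: "sl2_bracket h f = sl2_scale (-2) f"
    and ef: "sl2_bracket e f = h" and h0: "h \<noteq> 0"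
  shows "sl2.span {e, f, h} = UNIV"
proof -
  interpret T: subspace_endomorphism sl2_scale UNIV "sl2_bracket h"
    by unfold_locales (simp_all add: sl2.bracket_add_right sl2.bracket_scale_right)
  have e0: "e \<noteq> 0" using ef h0 by (auto simp: sl2.bracket_zero_left)
  have f0: "f \<noteq> 0"
    using ef h0 sl2.bracket_antisym[of e f] by (auto simp: sl2.bracket_zero_left)
  define g where "g c = (if c = 2 then e else if c = -2 then f else h)" for c :: 'k
  have "g c \<in> UNIV \<and> g c \<noteq> 0 \<and> sl2_bracket h (g c) = sl2_scale c (g c)" if "c \<in> {2, -2, 0}" for c
    using that e0 f0 h0 he hf by (auto simp: g_def sl2.bracket_self)
  note * = T.eigenvectors_independent[of "{2, -2, 0 :: 'k}" "\<lambda>c. c", OF _ _ this]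
  have neq: "(2 :: 'k) \<noteq> - 2" by (simp add: eq_neg_iff_add_eq_0)
  have img: "g ` {2, -2, 0} = {e, f, h}" using neq by (auto simp: g_def)
  have ind: "sl2.independent {e, f, h}" using *(2) img by simp
  have "card (g ` {2, -2, 0}) = 3" using *(1) neq by (subst card_image) auto
  then have card: "card {e, f, h} = 3" unfolding img .
  have "A \<in> sl2.span {e, f, h}" for A
  proof (rule ccontr)
    assume A: "A \<notin> sl2.span {e, f, h}"
    then have "sl2.independent (insert A {e, f, h})"
      using ind by (rule sl2.independent_insertI)
    then have "card (insert A {e, f, h}) \<le> card {sl2_e, sl2_f, sl2_h :: 'k sl2}"
      using sl2.independent_span_bound[of "{sl2_e, sl2_f, sl2_h}" "insert A {e, f, h}"]
      by (simp add: sl2_standard_span)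
    also have "\<dots> \<le> 3" using card_length[of "[sl2_e, sl2_f, sl2_h :: 'k sl2]"] by simp
    finally have "card (insert A {e, f, h}) \<le> 3" .
    moreover have "A \<notin> {e, f, h}" by (rule contra_subsetD[OF sl2.span_superset A])
    then have "card (insert A {e, f, h}) = Suc (card {e, f, h})"
      by (intro card_insert_disjoint) simp_all
    ultimately show False using card by linarith
  qed
  then show ?thesis by blast
qed

section \<open>Images of distinguished elements under the evaluation homomorphism\<close>

lemma is_EV_EV: "a \<noteq> 0 \<Longrightarrow> a \<noteq> 1 \<Longrightarrow> is_EV a (EV a)"
  unfolding EV_def by (rule theI'[of "is_EV a", OF EV_ex1])

lemma
  fixes a :: "'k::field"
  assumes "a \<noteq> 0" "a \<noteq> 1"
  shows EV_linear: "Vector_Spaces.linear tet_scale sl2_scale (EV a)"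
    and EV_bracket: "EV a (tet_bracket \<xi> \<eta>) = sl2_bracket (EV a \<xi>) (EV a \<eta>)"
  using is_EV_EV[OF assms] by (simp_all add: is_EV_def lie_hom_def)

lemma tet_x_swap: "i \<noteq> j \<Longrightarrow> tet_x i j = - tet_x j i"
  using tet_x_antisym[of i j] by (simp add: eq_neg_iff_add_eq_0)

text \<open>Nonvanishing of \<open>h\<close> is what makes the image of a triple span
  \<open>sl2\<close>. Six generators are checked by matrix entries, the rest follow by
  antisymmetry.\<close>

lemma EV_tet_x_nonzero:
  fixes a :: "'k::field_char_0"
  assumes a: "a \<noteq> 0" "a \<noteq> 1" and ij: "i \<noteq> j"
  shows "EV a (tet_x i j) \<noteq> 0"
proof -
  interpret L: Vector_Spaces.linear tet_scale sl2_scale "EV a" by (rule EV_linear[OF a])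
  have "EV a (tet_x I1 I2) \<noteq> 0" "EV a (tet_x I2 I3) \<noteq> 0" "EV a (tet_x I3 I1) \<noteq> 0"
    "EV a (tet_x I0 I3) \<noteq> 0" "EV a (tet_x I0 I1) \<noteq> 0" "EV a (tet_x I0 I2) \<noteq> 0"
    using is_EV_EV[OF a] a
    by (auto simp: is_EV_def sl2_eq_iff sl2_entries sl2_x_def sl2_y_def sl2_z_def)
  moreover have "tet_x i j = - (tet_x j i :: 'k tetrahedron)" using ij by (rule tet_x_swap)
  ultimately show ?thesis
    using ij by (cases i; cases j) (simp_all add: L.neg)
qed

text \<open>The image is \<open>(z + x)/2\<close> with \<open>z = h\<close> and
  \<open>x = 2e - h\<close>.\<close>

lemma EV_tet_e_minus:
  fixes a :: "'k::field_char_0"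
  assumes a: "a \<noteq> 0" "a \<noteq> 1"
  shows "EV a tet_e_minus = sl2_e"
proof -
  interpret L: Vector_Spaces.linear tet_scale sl2_scale "EV a" by (rule EV_linear[OF a])
  show ?thesis
    using is_EV_EV[OF a]
    by (simp add: is_EV_def tet_e_minus_def L.add L.scale sl2_eq_iff sl2_entries sl2_x_def sl2_z_def)
qed

text \<open>The image is \<open>-(a y + a z)/2\<close> with \<open>y + z = -2f\<close>. The factor
  \<open>a\<close> found here is the source of the powers of the evaluation parameters in the
  Drinfel'd polynomial.\<close>

lemma EV_tet_e_plus:
  fixes a :: "'k::field_char_0"
  assumes a: "a \<noteq> 0" "a \<noteq> 1"
  shows "EV a tet_e_plus = sl2_scale a sl2_f"
proof -
  interpret L: Vector_Spaces.linear tet_scale sl2_scale "EV a" by (rule EV_linear[OF a])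
  show ?thesis
    using is_EV_EV[OF a]
    by (simp add: is_EV_def tet_e_plus_def tet_x_swap[of I1 I3] tet_x_swap[of I3 I0]
        L.add L.neg L.diff L.scale sl2_eq_iff sl2_entries sl2_y_def sl2_z_def)
qed

text \<open>The relations are imposed on the images under \<open>EV a\<close>, so that the lemma
  covers both the triples of equitable generators and the one built from \<open>tet_e_minus\<close>
  and \<open>tet_e_plus\<close>.\<close>

lemma evaluation_module_basis:
  fixes scaleW :: "'k::{alg_closed_field, field_char_0} \<Rightarrow> 'w::ab_group_add \<Rightarrow> 'w"
  assumes ev: "is_evaluation_module d a scaleW W act"
    and he: "sl2_bracket (EV a h) (EV a e) = sl2_scale 2 (EV a e)"
    and hf: "sl2_bracket (EV a h) (EV a f) = sl2_scale (-2) (EV a f)"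
    and ef: "sl2_bracket (EV a e) (EV a f) = EV a h" and h0: "EV a h \<noteq> 0"
  obtains u :: "nat \<Rightarrow> 'w" where
    "W = module.span scaleW (u ` {..d})" "\<And>n. u n \<in> W"
    "\<And>n. n \<le> d \<Longrightarrow> u n \<noteq> 0"
    "\<And>n. act h (u n) = scaleW (of_nat d - 2 * of_nat n) (u n)"
    "\<And>n. act f (u n) = scaleW (of_nat (Suc n)) (u (Suc n))"
    "act e (u 0) = 0"
    "\<And>n. act e (u (Suc n)) = scaleW (of_nat d - of_nat n) (u n)"
proof -
  obtain \<rho> where mod: "lie_module sl2_scale sl2_bracket scaleW W \<rho>"
    and irr: "irreducible_module scaleW W \<rho>" and dim: "vector_space.dim scaleW W = d + 1"
    and act: "\<And>\<xi> w. w \<in> W \<Longrightarrow> act \<xi> w = \<rho> (EV a \<xi>) w"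
    using ev unfolding is_evaluation_module_def by blast
  interpret lie_module sl2_scale sl2_bracket scaleW W \<rho> by fact
  have "U = {0} \<or> U = W" if U: "V.subspace U" "U \<subseteq> W"
    and inv: "\<And>u. u \<in> U \<Longrightarrow> \<rho> (EV a e) u \<in> U \<and> \<rho> (EV a f) u \<in> U \<and> \<rho> (EV a h) u \<in> U" for U
  proof -
    have "\<rho> A u \<in> U" if u: "u \<in> U" for A u
    proof -
      have uW: "u \<in> W" using u U by auto
      \<comment> \<open>The elements mapping \<open>u\<close> into \<open>U\<close> form a subspace
        containing the triple, hence all of \<open>sl2\<close>; so invariance under the triple is
        invariance under \<open>sl2\<close>.\<close>
      have "sl2.subspace {A. \<rho> A u \<in> U}"
      proof (rule sl2.subspaceI)
        show "0 \<in> {A. \<rho> A u \<in> U}"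
          using act_scale_left[OF uW, of 0 0] V.subspace_0[OF U(1)] by simp
      qed (use uW U in \<open>auto simp: act_add_left act_scale_left V.subspace_add V.subspace_scale\<close>)
      moreover have "{EV a e, EV a f, EV a h} \<subseteq> {A. \<rho> A u \<in> U}" using inv[OF u] by simp
      ultimately have "sl2.span {EV a e, EV a f, EV a h} \<subseteq> {A. \<rho> A u \<in> U}"
        by (rule sl2.span_minimal[rotated])
      then show ?thesis using sl2_triple_span[OF he hf ef h0] by auto
    qed
    then show ?thesis using irr U unfolding irreducible_module_def by blast
  qed
  then obtain u :: "nat \<Rightarrow> 'w" where u: "W = V.span (u ` {..d})"
    "\<And>n. n \<le> d \<Longrightarrow> u n \<noteq> 0" "\<And>n. n > d \<Longrightarrow> u n = 0"
    "\<And>n. \<rho> (EV a h) (u n) = scaleW (of_nat d - 2 * of_nat n) (u n)"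
    "\<And>n. \<rho> (EV a f) (u n) = scaleW (of_nat (Suc n)) (u (Suc n))"
    "\<rho> (EV a e) (u 0) = 0"
    "\<And>n. \<rho> (EV a e) (u (Suc n)) = scaleW (of_nat d - of_nat n) (u n)"
    using sl2_triple_irreducible_basis[OF mod he hf ef _ dim] by blast
  have uW: "u n \<in> W" for n
  proof (cases "n \<le> d")
    case True
    then show ?thesis unfolding u(1) by (intro V.span_base) auto
  next
    case False
    then show ?thesis using u(3) V.subspace_0[OF subspace_carrier] by simp
  qed
  show ?thesis
  proof
    show "W = V.span (u ` {..d})" by (fact u(1))
    show "\<And>n. u n \<in> W" by (fact uW)
  qed (simp_all add: act uW u(2-) del: of_nat_Suc)
qed

text \<open>Any third index \<open>k\<close> completes \<open>x_ij\<close> to a cyclic equitable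
  triple, and \<open>EV a\<close> carries its \<open>sl2\<close>-triple to one in
  \<open>sl2\<close>.\<close>

lemma evaluation_module_weight_basis:
  fixes scaleW :: "'k::{alg_closed_field, field_char_0} \<Rightarrow> 'w::ab_group_add \<Rightarrow> 'w"
  assumes ev: "is_evaluation_module d a scaleW W act" and ij: "i \<noteq> j"
  obtains u :: "nat \<Rightarrow> 'w" where
    "W = module.span scaleW (u ` {..d})" "\<And>n. u n \<in> W" "\<And>n. n \<le> d \<Longrightarrow> u n \<noteq> 0"
    "\<And>n. act (tet_x i j) (u n) = scaleW (of_nat d - 2 * of_nat n) (u n)"
proof -
  have a: "a \<noteq> 0" "a \<noteq> 1" using ev by (auto simp: is_evaluation_module_def)
  interpret L: Vector_Spaces.linear tet_scale sl2_scale "EV a" by (rule EV_linear[OF a])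
  obtain k where k: "distinct [i, j, k]"
    using ij by (cases i; cases j) (auto intro: that[of I0] that[of I1] that[of I2])
  define e where "e = tet_x i j + (tet_x j k :: 'k tetrahedron)"
  define f where "f = tet_scale (- 1 / 4) (tet_x i j + (tet_x k i :: 'k tetrahedron))"
  have "distinct [j, k, i]" "distinct [k, i, j]" using k by auto
  note triple = tetrahedron.sl2_triple_of_equitable
    [OF tet_x_bracket[OF k] tet_x_bracket[OF this(1)] tet_x_bracket[OF this(2)]]
  have "tet_bracket (tet_x i j) e = tet_scale 2 e"
    "tet_bracket (tet_x i j) f = tet_scale (-2) f"
    "tet_bracket e f = tet_x i j"
    unfolding e_def f_def by (rule triple; simp)+
  then have "sl2_bracket (EV a (tet_x i j)) (EV a e) = sl2_scale 2 (EV a e)"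
    "sl2_bracket (EV a (tet_x i j)) (EV a f) = sl2_scale (-2) (EV a f)"
    "sl2_bracket (EV a e) (EV a f) = EV a (tet_x i j)"
    by (simp_all only: EV_bracket[OF a, symmetric] L.scale)
  from evaluation_module_basis[OF ev this EV_tet_x_nonzero[OF a ij]] show ?thesis
    using that by metis
qed

lemma evaluation_module_ladder_basis:
  fixes scaleW :: "'k::{alg_closed_field, field_char_0} \<Rightarrow> 'w::ab_group_add \<Rightarrow> 'w"
  assumes ev: "is_evaluation_module d a scaleW W act"
  obtains u :: "nat \<Rightarrow> 'w" where
    "W = module.span scaleW (u ` {..d})" "\<And>n. u n \<in> W"
    "\<And>n. n \<le> d \<Longrightarrow> u n \<noteq> 0"
    "\<And>n. act (tet_x I3 I1) (u n) = scaleW (of_nat d - 2 * of_nat n) (u n)"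
    "\<And>n. act tet_e_plus (u n) = scaleW (a * of_nat (Suc n)) (u (Suc n))"
    "act tet_e_minus (u 0) = 0"
    "\<And>n. act tet_e_minus (u (Suc n)) = scaleW (of_nat d - of_nat n) (u n)"
proof -
  have a: "a \<noteq> 0" "a \<noteq> 1" using ev by (auto simp: is_evaluation_module_def)
  interpret L: Vector_Spaces.linear tet_scale sl2_scale "EV a" by (rule EV_linear[OF a])
  obtain \<rho> where mod: "lie_module sl2_scale sl2_bracket scaleW W \<rho>"
    and act: "\<And>\<xi> w. w \<in> W \<Longrightarrow> act \<xi> w = \<rho> (EV a \<xi>) w"
    using ev unfolding is_evaluation_module_def by blast
  interpret lie_module sl2_scale sl2_bracket scaleW W \<rho> by fact
  \<comment> \<open>Dividing by \<open>a\<close> makes \<open>x_31\<close>,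
    \<open>tet_e_minus\<close> and \<open>f\<close> map to the standard \<open>h\<close>,
    \<open>e\<close> and \<open>f\<close>.\<close>
  define f where "f = tet_scale (inverse a) tet_e_plus"
  have h: "EV a (tet_x I3 I1) = sl2_h"
    using is_EV_EV[OF a] by (simp add: is_EV_def sl2_z_def)
  have f: "EV a f = sl2_f"
    using a by (simp add: f_def L.scale EV_tet_e_plus)
  have "sl2_h \<noteq> (0 :: 'k sl2)" by (simp add: sl2_eq_iff sl2_entries)
  then obtain u :: "nat \<Rightarrow> 'w" where u: "W = V.span (u ` {..d})" "\<And>n. u n \<in> W"
    "\<And>n. n \<le> d \<Longrightarrow> u n \<noteq> 0"
    "\<And>n. act (tet_x I3 I1) (u n) = scaleW (of_nat d - 2 * of_nat n) (u n)"
    "\<And>n. act f (u n) = scaleW (of_nat (Suc n)) (u (Suc n))"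
    "act tet_e_minus (u 0) = 0"
    "\<And>n. act tet_e_minus (u (Suc n)) = scaleW (of_nat d - of_nat n) (u n)"
    using evaluation_module_basis[OF ev, of "tet_x I3 I1" tet_e_minus f]
    unfolding h f EV_tet_e_minus[OF a] using sl2_brackets by blast
  have "act tet_e_plus (u n) = scaleW (a * of_nat (Suc n)) (u (Suc n))" for n
  proof -
    have "act tet_e_plus (u n) = scaleW a (act f (u n))"
      using u(2) by (simp add: act EV_tet_e_plus[OF a] f act_scale_left)
    then show ?thesis by (simp add: u(5) del: of_nat_Suc)
  qed
  then show ?thesis using that[of u] u by blast
qed

section \<open>Multi-indices of given weight\<close>

text \<open>Values outside \<open>I\<close> are fixed by extensionality, so for finite
  \<open>I\<close> the set is finite.\<close>

definition multi_indices :: "'i set \<Rightarrow> nat \<Rightarrow> ('i \<Rightarrow> nat) set"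
  where "multi_indices I n = {m \<in> I \<rightarrow>\<^sub>E UNIV. sum m I = n}"

lemma multi_indices_eq_PiE:
  assumes "finite I" "n \<le> N"
  shows "multi_indices I n = {m \<in> I \<rightarrow>\<^sub>E {..N}. sum m I = n}"
proof -
  have "m j \<le> N" if "sum m I = n" "j \<in> I" for m :: "'a \<Rightarrow> nat" and j
    using member_le_sum[of j I m] that assms by auto
  then show ?thesis by (auto simp: multi_indices_def PiE_iff)
qed

lemma finite_multi_indices: "finite I \<Longrightarrow> finite (multi_indices I n)"
  by (simp add: multi_indices_eq_PiE[OF _ order_refl] finite_PiE)

lemma multi_indices_0: "finite I \<Longrightarrow> multi_indices I 0 = {\<lambda>j\<in>I. 0}"
  by (auto simp: multi_indices_def PiE_iff extensional_def)

text \<open>Adding the old and new entries on opposite sides avoids truncated subtraction.\<close>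

lemma sum_fun_upd:
  fixes m :: "'i \<Rightarrow> nat"
  shows "finite I \<Longrightarrow> j \<in> I \<Longrightarrow> sum (m(j := k)) I + m j = sum m I + k"
  by (simp add: sum.remove[of I j])

text \<open>Raising entry \<open>j\<close> maps the pairs \<open>(m, j)\<close> of weight
  \<open>n\<close> bijectively onto those of weight \<open>n + 1\<close> with
  \<open>m j \<noteq> 0\<close>; by \<open>f0\<close> the remaining pairs contribute 0.\<close>

lemma sum_multi_indices_Suc:
  fixes f :: "('i \<Rightarrow> nat) \<Rightarrow> 'i \<Rightarrow> 'v::comm_monoid_add"
  assumes I: "finite I" and f0: "\<And>m j. j \<in> I \<Longrightarrow> m j = 0 \<Longrightarrow> f m j = 0"
  shows "(\<Sum>m\<in>multi_indices I n. \<Sum>j\<in>I. f (m(j := Suc (m j))) j)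
    = (\<Sum>m\<in>multi_indices I (Suc n). \<Sum>j\<in>I. f m j)"
proof -
  note fin = finite_multi_indices[OF I]
  have "(\<Sum>m\<in>multi_indices I n. \<Sum>j\<in>I. f (m(j := Suc (m j))) j)
      = (\<Sum>(m, j)\<in>multi_indices I n \<times> I. f (m(j := Suc (m j))) j)"
    by (rule sum.cartesian_product)
  also have "\<dots> = (\<Sum>(m, j)\<in>{(m, j) \<in> multi_indices I (Suc n) \<times> I. m j \<noteq> 0}. f m j)"
  proof (rule sum.reindex_bij_witness[where
        i = "\<lambda>(m, j). (m(j := m j - 1), j)" and j = "\<lambda>(m, j). (m(j := Suc (m j)), j)"], goal_cases)
    case (2 p)
    obtain m j where p: "p = (m, j)" by (cases p)
    show ?case
      using 2 sum_fun_upd[OF I, of j m "Suc (m j)"]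
      by (auto simp: p multi_indices_def PiE_iff extensional_def)
  next
    case (4 p)
    obtain m j where p: "p = (m, j)" by (cases p)
    show ?case
      using 4 sum_fun_upd[OF I, of j m "m j - 1"]
      by (auto simp: p multi_indices_def PiE_iff extensional_def)
  qed auto
  also have "\<dots> = (\<Sum>(m, j)\<in>multi_indices I (Suc n) \<times> I. f m j)"
    using I fin by (intro sum.mono_neutral_left) (auto simp: f0 intro: gr0I)
  also have "\<dots> = (\<Sum>m\<in>multi_indices I (Suc n). \<Sum>j\<in>I. f m j)"
    by (rule sum.cartesian_product[symmetric])
  finally show ?thesis .
qed

text \<open>Filling the slots greedily reaches every total up to \<open>sum d I\<close>, so every
  expected weight occurs in the tensor product.\<close>

lemma multi_index_bounded_exists:
  fixes d :: "'i \<Rightarrow> nat"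
  assumes "finite I" "n \<le> sum d I"
  shows "\<exists>m\<in>Pi\<^sub>E I (\<lambda>j. {..d j}). sum m I = n"
  using assms
proof (induction I arbitrary: n rule: finite_induct)
  case (insert j I)
  define k where "k = min n (d j)"
  have "n - k \<le> sum d I" using insert by (auto simp: k_def)
  then obtain m where m: "m \<in> Pi\<^sub>E I (\<lambda>j. {..d j})" "sum m I = n - k"
    using insert.IH by blast
  have "sum (m(j := k)) I = sum m I" using insert by (intro sum.cong) auto
  then have "sum (m(j := k)) (insert j I) = n"
    using insert m by (simp add: k_def)
  moreover have "m(j := k) \<in> Pi\<^sub>E (insert j I) (\<lambda>j. {..d j})"
    using m by (intro PiE_fun_upd) (auto simp: k_def)
  ultimately show ?case by blast
qed auto

section \<open>Coefficients of products of polynomials\<close>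

lemma prod_monom: "(\<Prod>j\<in>I. monom (c j) (m j)) = monom (\<Prod>j\<in>I. c j) (\<Sum>j\<in>I. m j)"
  for c :: "'i \<Rightarrow> 'a::comm_semiring_1"
  by (induction I rule: infinite_finite_induct) (simp_all add: mult_monom)

lemma coeff_prod_multi_indices:
  fixes p :: "'i \<Rightarrow> 'a::comm_semiring_1 poly"
  assumes I: "finite I"
  shows "coeff (\<Prod>j\<in>I. p j) n = (\<Sum>m\<in>multi_indices I n. \<Prod>j\<in>I. coeff (p j) (m j))"
proof -
  \<comment> \<open>\<open>N\<close> bounds all degrees, so every factor is a sum over the same
    range, and also \<open>n\<close>, so no multi-index of weight \<open>n\<close> is cut
    off.\<close>
  define N where "N = n + (\<Sum>j\<in>I. degree (p j))"
  have "degree (p j) \<le> N" if "j \<in> I" for j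
    using member_le_sum[OF that, of "\<lambda>j. degree (p j)"] I by (simp add: N_def)
  then have "(\<Prod>j\<in>I. p j) = (\<Prod>j\<in>I. \<Sum>k\<le>N. monom (coeff (p j) k) k)"
    by (intro prod.cong) (simp_all add: poly_as_sum_of_monoms')
  also have "\<dots> = (\<Sum>m\<in>I \<rightarrow>\<^sub>E {..N}. monom (\<Prod>j\<in>I. coeff (p j) (m j)) (sum m I))"
    using I by (simp add: prod_sum_PiE prod_monom)
  also have "coeff \<dots> n = (\<Sum>m\<in>I \<rightarrow>\<^sub>E {..N}. if sum m I = n then \<Prod>j\<in>I. coeff (p j) (m j) else 0)"
    by (simp add: coeff_sum)
  also have "\<dots> = (\<Sum>m\<in>multi_indices I n. \<Prod>j\<in>I. coeff (p j) (m j))"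
    using I multi_indices_eq_PiE[OF I, of n N]
    by (simp add: N_def sum.inter_filter[symmetric] finite_PiE)
  finally show ?thesis .
qed

text \<open>Each factor contributes a binomial term with sign \<open>(-1) ^ m j\<close>; the
  exponents add up to \<open>n\<close>, so the sign is common to all summands.\<close>

lemma coeff_prod_linear_powers:
  fixes a :: "'i \<Rightarrow> 'a::comm_ring_1"
  assumes I: "finite I"
  shows "coeff (\<Prod>j\<in>I. [:1, - a j:] ^ d j) n
    = (-1) ^ n * (\<Sum>m\<in>multi_indices I n. \<Prod>j\<in>I. of_nat (d j choose m j) * a j ^ m j)"
proof -
  have "coeff ([:1, - a j:] ^ d j) k = (-1) ^ k * (of_nat (d j choose k) * a j ^ k)" for j k
  proof (cases "k \<le> d j")
    case True
    then show ?thesis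
      by (simp add: coeff_linear_poly_power power_minus[of "a j"] mult_ac)
  next
    case False
    have "degree ([:1, - a j:] ^ d j) \<le> 1 * d j"
      by (rule order.trans[OF degree_power_le]) (simp add: degree_pCons_le)
    then show ?thesis using False by (simp add: coeff_eq_0 binomial_eq_0)
  qed
  then show ?thesis
    by (auto simp: coeff_prod_multi_indices[OF I] prod.distrib sum_distrib_left multi_indices_def
        power_sum[symmetric] intro!: sum.cong)
qed

section \<open>Tensor products of modules\<close>

text \<open>Restriction to \<open>I\<close> makes the value depend on \<open>m\<close> only through
  its entries in \<open>I\<close>; the constant function 0 can thus stand for the zero
  multi-index.\<close>

definition (in tensor_product) tensor_family :: "('i \<Rightarrow> nat \<Rightarrow> 'w) \<Rightarrow> ('i \<Rightarrow> nat) \<Rightarrow> 'v"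
  where "tensor_family u m = \<tau> (\<lambda>j\<in>I. u j (m j))"

locale module_tensor_product =
  lie_module scaleL bracket scaleV V act + tensor_product scaleV I scaleW W V \<tau>
  for scaleL :: "'k::field_char_0 \<Rightarrow> 'l::ab_group_add \<Rightarrow> 'l" and bracket
    and scaleV :: "'k \<Rightarrow> 'v::ab_group_add \<Rightarrow> 'v" and V act
    and I :: "'i set" and scaleW :: "'k \<Rightarrow> 'w::ab_group_add \<Rightarrow> 'w" and W \<tau> +
  fixes actW :: "'i \<Rightarrow> 'l \<Rightarrow> 'w \<Rightarrow> 'w"
  assumes act_tensor:
    "w \<in> Pi\<^sub>E I W \<Longrightarrow> act \<xi> (\<tau> w) = (\<Sum>j\<in>I. \<tau> (w(j := actW j \<xi> (w j))))"
begin

text \<open>The indices \<open>k j\<close> are left free so that one Leibniz formula serves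
  diagonal, raising and lowering elements.\<close>

lemma act_tensor_family:
  assumes uW: "\<And>j n. j \<in> I \<Longrightarrow> u j n \<in> W j"
    and act: "\<And>j. j \<in> I \<Longrightarrow> actW j \<xi> (u j (m j)) = scaleW (c j) (u j (k j))"
  shows "act \<xi> (tensor_family u m) = (\<Sum>j\<in>I. scaleV (c j) (tensor_family u (m(j := k j))))"
proof -
  let ?w = "\<lambda>j\<in>I. u j (m j)"
  have w: "?w \<in> Pi\<^sub>E I W" using uW by auto
  have "\<tau> (?w(j := actW j \<xi> (?w j))) = scaleV (c j) (tensor_family u (m(j := k j)))" if j: "j \<in> I" for j
  proof -
    have "\<tau> (?w(j := actW j \<xi> (?w j))) = \<tau> (?w(j := scaleW (c j) (u j (k j))))"
      using j by (simp add: act)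
    also have "\<dots> = scaleV (c j) (\<tau> (?w(j := u j (k j))))"
      using w j uW by (intro tensor_scale) auto
    also have "?w(j := u j (k j)) = (\<lambda>i\<in>I. u i ((m(j := k j)) i))"
      using j by auto
    finally show ?thesis unfolding tensor_family_def .
  qed
  then show ?thesis
    unfolding tensor_family_def[of u m] act_tensor[OF w] by (intro sum.cong) auto
qed

text \<open>The tensors of weight vectors span \<open>V\<close> and are eigenvectors, with
  eigenvalue \<open>sum d I - 2 * sum m I\<close>. All claims are read off from this family; the top
  eigenvalue belongs to the zero multi-index alone.\<close>

lemma tensor_weights:
  assumes span: "\<And>j. j \<in> I \<Longrightarrow> W j = module.span scaleW (u j ` {..d j})"
    and uW: "\<And>j n. j \<in> I \<Longrightarrow> u j n \<in> W j"
    and nz: "\<And>j n. j \<in> I \<Longrightarrow> n \<le> d j \<Longrightarrow> u j n \<noteq> 0"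
    and act: "\<And>j n. j \<in> I \<Longrightarrow>
      actW j \<xi> (u j n) = scaleW (of_nat (d j) - 2 * of_nat n) (u j n)"
  shows "semisimple_on scaleV V (act \<xi>)"
    and "eigenvalues_on scaleV V (act \<xi>) = {of_nat (sum d I) - 2 * of_nat n | n. n \<le> sum d I}"
    and "eigenspace_on scaleV V (act \<xi>) (of_nat (sum d I))
      = range (\<lambda>c. scaleV c (tensor_family u (\<lambda>_. 0)))"
    and "tensor_family u (\<lambda>_. 0) \<noteq> 0"
proof -
  interpret X: subspace_endomorphism scaleV V "act \<xi>" by (rule subspace_endomorphism_act)
  define \<Lambda> where "\<Lambda> = Pi\<^sub>E I (\<lambda>j. {..d j})"
  define b where "b = tensor_family u"
  define \<theta> where "\<theta> m = (of_nat (sum d I) - 2 * of_nat (sum m I) :: 'k)" for m :: "'i \<Rightarrow> nat"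
  have fin: "finite \<Lambda>" using finite_I by (simp add: \<Lambda>_def finite_PiE)
  have bV: "b m \<in> V" for m
    unfolding b_def tensor_family_def using uW by (intro tensor_in_V) auto
  have b0: "b m \<noteq> 0" if "\<And>j. j \<in> I \<Longrightarrow> m j \<le> d j" for m
    unfolding b_def tensor_family_def using uW nz that by (intro tensor_nonzero) auto
  \<comment> \<open>With \<open>k = m\<close> no index changes, so the scalars of the factors simply
    add up.\<close>
  have eig: "act \<xi> (b m) = scaleV (\<theta> m) (b m)" for m
    unfolding b_def using uW act
    by (subst act_tensor_family[where c = "\<lambda>j. of_nat (d j) - 2 * of_nat (m j)" and k = m])
      (simp_all add: \<theta>_def sum_subtractf sum_distrib_left of_nat_sum flip: V.scale_sum_left)
  have "\<tau> ` Pi\<^sub>E I (\<lambda>j. u j ` {..d j}) \<subseteq> b ` \<Lambda>"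
  proof
    fix x assume "x \<in> \<tau> ` Pi\<^sub>E I (\<lambda>j. u j ` {..d j})"
    then obtain w where w: "w \<in> Pi\<^sub>E I (\<lambda>j. u j ` {..d j})" "x = \<tau> w" by blast
    then have "\<forall>j\<in>I. \<exists>n\<le>d j. w j = u j n" by auto
    then obtain m where m: "\<And>j. j \<in> I \<Longrightarrow> m j \<le> d j \<and> w j = u j (m j)" by metis
    have "w = (\<lambda>j\<in>I. u j ((\<lambda>j\<in>I. m j) j))"
      using w m by (auto simp: PiE_iff extensional_def fun_eq_iff)
    then have "x = b (\<lambda>j\<in>I. m j)" using w by (simp add: b_def tensor_family_def)
    then show "x \<in> b ` \<Lambda>" using m by (auto simp: \<Lambda>_def)
  qed
  then have "V \<subseteq> V.span (b ` \<Lambda>)"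
    using tensor_basis_span[of "\<lambda>j. u j ` {..d j}"] span V.span_mono by metis
  moreover have bspan: "V.span (b ` \<Lambda>) \<subseteq> V"
    using bV subspace_carrier by (intro V.span_minimal) auto
  ultimately have V: "V = V.span (b ` \<Lambda>)" by (rule subset_antisym)
  have bE: "b m \<in> eigenspace_on scaleV V (act \<xi>) (\<theta> m)" for m
    by (simp add: eigenspace_on_def bV eig)
  have "V \<subseteq> V.span (\<Union>\<eta>. eigenspace_on scaleV V (act \<xi>) \<eta>)"
    using bE by (subst V) (intro V.span_mono, auto)
  moreover have "V.span (\<Union>\<eta>. eigenspace_on scaleV V (act \<xi>) \<eta>) \<subseteq> V"
    using subspace_carrier by (intro V.span_minimal) (auto simp: eigenspace_on_def)
  ultimately show "semisimple_on scaleV V (act \<xi>)"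
    unfolding semisimple_on_def by (rule subset_antisym)
  have in_span: "v \<in> V.span (b ` {m \<in> \<Lambda>. \<theta> m = \<eta>})"
    if "v \<in> eigenspace_on scaleV V (act \<xi>) \<eta>" for v \<eta>
    using that fin bV eig V by (intro X.eigenvector_in_span) (auto simp: eigenspace_on_def)
  show "eigenvalues_on scaleV V (act \<xi>) = {of_nat (sum d I) - 2 * of_nat n | n. n \<le> sum d I}"
  proof (intro set_eqI iffI)
    fix \<eta> assume "\<eta> \<in> eigenvalues_on scaleV V (act \<xi>)"
    then obtain v where v: "v \<in> eigenspace_on scaleV V (act \<xi>) \<eta>" "v \<noteq> 0"
      by (auto simp: eigenvalues_on_def)
    have "{m \<in> \<Lambda>. \<theta> m = \<eta>} \<noteq> {}"
    proof
      assume empty: "{m \<in> \<Lambda>. \<theta> m = \<eta>} = {}"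
      show False using in_span[OF v(1)] v(2) unfolding empty by simp
    qed
    then obtain m where m: "m \<in> \<Lambda>" "\<theta> m = \<eta>" by blast
    then have "sum m I \<le> sum d I" by (intro sum_mono) (auto simp: \<Lambda>_def)
    then show "\<eta> \<in> {of_nat (sum d I) - 2 * of_nat n | n. n \<le> sum d I}"
      using m(2)[unfolded \<theta>_def, symmetric] by blast
  next
    fix \<eta> :: 'k assume "\<eta> \<in> {of_nat (sum d I) - 2 * of_nat n | n. n \<le> sum d I}"
    then obtain n where n: "n \<le> sum d I" "\<eta> = of_nat (sum d I) - 2 * of_nat n" by blast
    then obtain m where m: "m \<in> \<Lambda>" "sum m I = n"
      using multi_index_bounded_exists[OF finite_I] by (auto simp: \<Lambda>_def)
    then have "b m \<noteq> 0" "\<theta> m = \<eta>" using n by (auto intro!: b0 simp: \<Lambda>_def \<theta>_def)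
    then show "\<eta> \<in> eigenvalues_on scaleV V (act \<xi>)"
      using bE[of m] by (auto simp: eigenvalues_on_def)
  qed
  show "eigenspace_on scaleV V (act \<xi>) (of_nat (sum d I))
      = range (\<lambda>c. scaleV c (tensor_family u (\<lambda>_. 0)))"
  proof (intro subset_antisym subsetI)
    fix v assume v: "v \<in> eigenspace_on scaleV V (act \<xi>) (of_nat (sum d I))"
    have "m \<in> multi_indices I 0" if "m \<in> \<Lambda>" "\<theta> m = of_nat (sum d I)" for m
    proof -
      have "of_nat (sum m I) = (0 :: 'k)" using that(2) unfolding \<theta>_def by simp
      then have "sum m I = 0" unfolding of_nat_eq_0_iff .
      then show ?thesis using that(1) by (auto simp: multi_indices_def \<Lambda>_def PiE_iff)
    qed
    then have sub: "{m \<in> \<Lambda>. \<theta> m = of_nat (sum d I)} \<subseteq> {\<lambda>j\<in>I. 0}"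
      unfolding multi_indices_0[OF finite_I] by blast
    have "v \<in> V.span (b ` {\<lambda>j\<in>I. 0})"
      by (rule subsetD[OF V.span_mono[OF image_mono[OF sub]] in_span[OF v]])
    moreover have "b (\<lambda>j\<in>I. 0) = b (\<lambda>_. 0)"
      unfolding b_def tensor_family_def by (rule arg_cong[where f = \<tau>]) auto
    ultimately show "v \<in> range (\<lambda>c. scaleV c (tensor_family u (\<lambda>_. 0)))"
      by (simp add: V.span_singleton b_def)
  next
    fix v assume "v \<in> range (\<lambda>c. scaleV c (tensor_family u (\<lambda>_. 0)))"
    then obtain c where "v = scaleV c (b (\<lambda>_. 0))" by (auto simp: b_def)
    then show "v \<in> eigenspace_on scaleV V (act \<xi>) (of_nat (sum d I))"
      using bV eig[of "\<lambda>_. 0"]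
      by (simp add: eigenspace_on_def V.subspace_scale[OF subspace_carrier] X.T_scale \<theta>_def mult.commute)
  qed
  show "tensor_family u (\<lambda>_. 0) \<noteq> 0"
    using b0[of "\<lambda>_. 0"] by (simp add: b_def)
qed

text \<open>A tensor of index \<open>m\<close> arises from lowering one entry \<open>m j\<close>,
  with factor \<open>a j * m j\<close>. As the entries sum to \<open>i + 1\<close>, the factors
  \<open>m j\<close> together turn \<open>i!\<close> into \<open>(i + 1)!\<close>.\<close>

lemma raise_power_tensor_family:
  assumes uW: "\<And>j n. j \<in> I \<Longrightarrow> u j n \<in> W j"
    and act: "\<And>j n. j \<in> I \<Longrightarrow> actW j \<xi> (u j n) = scaleW (a j * of_nat (Suc n)) (u j (Suc n))"
  shows "(act \<xi> ^^ i) (tensor_family u (\<lambda>_. 0))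
    = (\<Sum>m\<in>multi_indices I i. scaleV (fact i * (\<Prod>j\<in>I. a j ^ m j)) (tensor_family u m))"
proof (induction i)
  case 0
  define z :: "'i \<Rightarrow> nat" where "z = (\<lambda>j\<in>I. 0)"
  have "tensor_family u z = tensor_family u (\<lambda>_. 0)"
    unfolding tensor_family_def by (rule arg_cong[where f = \<tau>]) (auto simp: z_def)
  moreover have "(\<Prod>j\<in>I. a j ^ z j) = 1" by (intro prod.neutral) (auto simp: z_def)
  ultimately show ?case unfolding multi_indices_0[OF finite_I] z_def[symmetric] by simp
next
  case (Suc i)
  interpret X: subspace_endomorphism scaleV V "act \<xi>" by (rule subspace_endomorphism_act)
  define A where "A m = (\<Prod>j\<in>I. a j ^ m j)" for m :: "'i \<Rightarrow> nat"
  have bV: "tensor_family u m \<in> V" for m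
    unfolding tensor_family_def using uW by (intro tensor_in_V) auto
  have A: "A m * a j = A (m(j := Suc (m j)))" if "j \<in> I" for m j
  proof -
    have "(\<Prod>k\<in>I - {j}. a k ^ (m(j := Suc (m j))) k) = (\<Prod>k\<in>I - {j}. a k ^ m k)"
      by (intro prod.cong) auto
    then show ?thesis
      unfolding A_def using finite_I that by (simp add: prod.remove[of I j] mult_ac)
  qed
  have "(act \<xi> ^^ Suc i) (tensor_family u (\<lambda>_. 0))
      = (\<Sum>m\<in>multi_indices I i. scaleV (fact i * A m) (act \<xi> (tensor_family u m)))"
    using X.funpow_sum_scale[of "multi_indices I i" "tensor_family u" 1] bV
    by (simp add: Suc A_def)
  \<comment> \<open>Each summand is rewritten in terms of the raised index alone, the form that
    \<open>sum_multi_indices_Suc\<close> reindexes.\<close>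
  also have "\<dots> = (\<Sum>m\<in>multi_indices I i. \<Sum>j\<in>I.
      scaleV (fact i * A (m(j := Suc (m j))) * of_nat ((m(j := Suc (m j))) j))
        (tensor_family u (m(j := Suc (m j)))))"
  proof (intro sum.cong refl)
    fix m
    have "scaleV (fact i * A m) (act \<xi> (tensor_family u m))
        = (\<Sum>j\<in>I. scaleV (fact i * A m) (scaleV (a j * of_nat (Suc (m j)))
            (tensor_family u (m(j := Suc (m j))))))"
      using uW act
      by (subst act_tensor_family[where c = "\<lambda>j. a j * of_nat (Suc (m j))" and k = "\<lambda>j. Suc (m j)"])
        (simp_all add: V.scale_sum_right del: of_nat_Suc)
    also have "\<dots> = (\<Sum>j\<in>I. scaleV (fact i * A (m(j := Suc (m j))) * of_nat ((m(j := Suc (m j))) j))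
        (tensor_family u (m(j := Suc (m j)))))"
      by (intro sum.cong refl) (simp add: A[symmetric] mult.assoc del: of_nat_Suc)
    finally show "scaleV (fact i * A m) (act \<xi> (tensor_family u m)) = \<dots>" .
  qed
  also have "\<dots> = (\<Sum>m\<in>multi_indices I (Suc i). \<Sum>j\<in>I.
      scaleV (fact i * A m * of_nat (m j)) (tensor_family u m))"
    using finite_I by (rule sum_multi_indices_Suc) simp
  also have "\<dots> = (\<Sum>m\<in>multi_indices I (Suc i). scaleV (fact (Suc i) * A m) (tensor_family u m))"
  proof (intro sum.cong refl)
    fix m assume "m \<in> multi_indices I (Suc i)"
    then have "(\<Sum>j\<in>I. of_nat (m j)) = (of_nat (Suc i) :: 'k)"
      unfolding multi_indices_def of_nat_sum[symmetric] by simp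
    then have "(\<Sum>j\<in>I. fact i * A m * of_nat (m j)) = fact (Suc i) * A m"
      by (simp add: sum_distrib_left[symmetric] mult_ac del: of_nat_Suc)
    then show "(\<Sum>j\<in>I. scaleV (fact i * A m * of_nat (m j)) (tensor_family u m))
        = scaleV (fact (Suc i) * A m) (tensor_family u m)"
      by (simp only: V.scale_sum_left[symmetric])
  qed
  finally show ?case unfolding A_def .
qed

text \<open>The number of steps equals the weight of \<open>m\<close>, so every path ends at the
  zero multi-index. The binomials come from
  \<open>(d - k) (d choose k) = (k + 1) (d choose (k + 1))\<close>, the factorial from the entries
  summing to \<open>i + 1\<close>.\<close>

lemma lower_power_tensor_family:
  assumes uW: "\<And>j n. j \<in> I \<Longrightarrow> u j n \<in> W j"
    and act0: "\<And>j. j \<in> I \<Longrightarrow> actW j \<xi> (u j 0) = 0"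
    and act: "\<And>j n. j \<in> I \<Longrightarrow> actW j \<xi> (u j (Suc n)) = scaleW (of_nat (d j) - of_nat n) (u j n)"
    and m: "m \<in> multi_indices I i"
  shows "(act \<xi> ^^ i) (tensor_family u m)
    = scaleV (fact i * (\<Prod>j\<in>I. of_nat (d j choose m j))) (tensor_family u (\<lambda>_. 0))"
  using m
proof (induction i arbitrary: m)
  case 0
  then have m: "m = (\<lambda>j\<in>I. 0)" by (simp add: multi_indices_0 finite_I)
  have "tensor_family u m = tensor_family u (\<lambda>_. 0)"
    unfolding tensor_family_def by (rule arg_cong[where f = \<tau>]) (auto simp: m)
  moreover have "(\<Prod>j\<in>I. of_nat (d j choose m j)) = (1 :: 'k)" by (intro prod.neutral) (auto simp: m)
  ultimately show ?case by simp
next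
  case (Suc i)
  interpret X: subspace_endomorphism scaleV V "act \<xi>" by (rule subspace_endomorphism_act)
  define C where "C m = (\<Prod>j\<in>I. of_nat (d j choose m j) :: 'k)" for m
  \<comment> \<open>The value 0 at \<open>m j = 0\<close> encodes that \<open>\<xi>\<close> kills
    \<open>u j 0\<close>, and makes the truncated \<open>m j - 1\<close> harmless.\<close>
  define c where "c j = (if m j = 0 then 0 else of_nat (d j) - of_nat (m j - 1) :: 'k)" for j
  have bV: "tensor_family u m \<in> V" for m
    unfolding tensor_family_def using uW by (intro tensor_in_V) auto
  have binom: "(of_nat n - of_nat k) * of_nat (n choose k) = of_nat (Suc k) * (of_nat (n choose Suc k) :: 'k)"
    for n k :: nat
  proof (cases "k \<le> n")
    case True
    have "(n - k) * (n choose k) = Suc k * (n choose Suc k)"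
      by (simp only: binomial_absorb_comp binomial_absorption)
    then have "of_nat ((n - k) * (n choose k)) = (of_nat (Suc k * (n choose Suc k)) :: 'k)"
      by (rule arg_cong)
    then show ?thesis using True by (simp only: of_nat_mult of_nat_diff)
  qed (simp add: binomial_eq_0)
  have cC: "c j * C (m(j := m j - 1)) = of_nat (m j) * C m" if "j \<in> I" for j
  proof (cases "m j")
    case (Suc n)
    have "(\<Prod>k\<in>I - {j}. of_nat (d k choose (m(j := m j - 1)) k))
        = (\<Prod>k\<in>I - {j}. of_nat (d k choose m k) :: 'k)"
      by (intro prod.cong) auto
    then show ?thesis
      unfolding C_def using finite_I that binom[of "d j" n]
      by (simp add: prod.remove[of I j] c_def Suc mult.assoc[symmetric] del: of_nat_Suc)
  qed (simp add: c_def)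
  have step: "scaleV (c j) ((act \<xi> ^^ i) (tensor_family u (m(j := m j - 1))))
      = scaleV (fact i * C m * of_nat (m j)) (tensor_family u (\<lambda>_. 0))" if j: "j \<in> I" for j
  proof (cases "m j = 0")
    case False
    then have "m(j := m j - 1) \<in> multi_indices I i"
      using Suc.prems j sum_fun_upd[OF finite_I j, of m "m j - 1"]
      by (auto simp: multi_indices_def PiE_iff extensional_def)
    then have "(act \<xi> ^^ i) (tensor_family u (m(j := m j - 1)))
        = scaleV (fact i * C (m(j := m j - 1))) (tensor_family u (\<lambda>_. 0))"
      unfolding C_def by (rule Suc.IH)
    then have "scaleV (c j) ((act \<xi> ^^ i) (tensor_family u (m(j := m j - 1))))
        = scaleV (fact i * (c j * C (m(j := m j - 1)))) (tensor_family u (\<lambda>_. 0))"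
      by (simp only: V.scale_scale mult.left_commute)
    then show ?thesis unfolding cC[OF j] by (simp only: mult_ac)
  qed (simp add: c_def)
  have actW: "actW j \<xi> (u j (m j)) = scaleW (c j) (u j (m j - 1))" if j: "j \<in> I" for j
  proof -
    interpret W: vector_space scaleW using vector_space_W[OF j] .
    show ?thesis using act0[OF j] act[OF j] by (cases "m j") (simp_all add: c_def)
  qed
  have "act \<xi> (tensor_family u m) = (\<Sum>j\<in>I. scaleV (c j) (tensor_family u (m(j := m j - 1))))"
    using uW actW by (rule act_tensor_family)
  \<comment> \<open>The innermost application is expanded first, leaving \<open>i\<close>
    applications to indices of weight \<open>i\<close>, as the induction hypothesis
    requires.\<close>
  then have "(act \<xi> ^^ Suc i) (tensor_family u m)
      = (\<Sum>j\<in>I. scaleV (c j) ((act \<xi> ^^ i) (tensor_family u (m(j := m j - 1)))))"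
    using bV by (simp add: funpow_Suc_right X.funpow_sum_scale del: funpow.simps)
  also have "\<dots> = (\<Sum>j\<in>I. scaleV (fact i * C m * of_nat (m j)) (tensor_family u (\<lambda>_. 0)))"
    using step by (intro sum.cong) auto
  also have "\<dots> = scaleV (\<Sum>j\<in>I. fact i * C m * of_nat (m j)) (tensor_family u (\<lambda>_. 0))"
    by (rule V.scale_sum_left[symmetric])
  also have "(\<Sum>j\<in>I. fact i * C m * of_nat (m j)) = fact (Suc i) * C m"
  proof -
    have "(\<Sum>j\<in>I. of_nat (m j)) = (of_nat (Suc i) :: 'k)"
      using Suc.prems unfolding multi_indices_def of_nat_sum[symmetric] by simp
    then show ?thesis
      by (simp add: sum_distrib_left[symmetric] mult_ac del: of_nat_Suc)
  qed
  finally show ?case unfolding C_def .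
qed

end

section \<open>The Drinfel'd polynomial\<close>

text \<open>In characteristic 0 the set for \<open>d\<close> has exactly \<open>d + 1\<close>
  elements.\<close>

lemma weight_set_inject:
  assumes "{of_nat d - 2 * of_nat n | n. n \<le> d} = ({of_nat e - 2 * of_nat n | n. n \<le> e} :: 'k::field_char_0 set)"
  shows "d = e"
proof -
  have card: "card {of_nat d - 2 * of_nat n :: 'k | n. n \<le> d} = Suc d" for d :: nat
  proof -
    have "{of_nat d - 2 * of_nat n :: 'k | n. n \<le> d} = (\<lambda>n. of_nat d - 2 * of_nat n) ` {..d}" by auto
    then show ?thesis by (simp add: card_image inj_on_def)
  qed
  from arg_cong[OF assms, of card] show ?thesis unfolding card by (rule Suc_inject)
qed

text \<open>\<open>tet_diameter\<close> is a definite description, so uniqueness must be shown too;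
  the eigenvalues of one generator settle it.\<close>

lemma tet_diameter_eqI:
  fixes scaleV :: "'k::field_char_0 \<Rightarrow> 'v::ab_group_add \<Rightarrow> 'v"
  assumes "\<And>i j. i \<noteq> j \<Longrightarrow> semisimple_on scaleV V (act (tet_x i j))"
    and "\<And>i j. i \<noteq> j \<Longrightarrow>
      eigenvalues_on scaleV V (act (tet_x i j)) = {of_nat d - 2 * of_nat n | n. n \<le> d}"
  shows "tet_diameter scaleV V act = d"
  unfolding tet_diameter_def
proof (rule the_equality)
  show "\<forall>i j. i \<noteq> j \<longrightarrow> semisimple_on scaleV V (act (tet_x i j)) \<and>
      eigenvalues_on scaleV V (act (tet_x i j)) = {of_nat d - 2 * of_nat n | n. n \<le> d}"
    using assms by blast
next
  fix e assume "\<forall>i j. i \<noteq> j \<longrightarrow> semisimple_on scaleV V (act (tet_x i j)) \<and>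
      eigenvalues_on scaleV V (act (tet_x i j)) = {of_nat e - 2 * of_nat n | n. n \<le> e}"
  then have "eigenvalues_on scaleV V (act (tet_x I0 I1)) = {of_nat e - 2 * of_nat n | n. n \<le> e}"
    by blast
  with assms(2)[of I0 I1] show "e = d" by (intro weight_set_inject[where 'k = 'k]) simp
qed

lemma drinfeld_poly_eqI:
  assumes "\<And>i. drinfeld_theta scaleV V act i = (-1) ^ i * (fact i)\<^sup>2 * coeff P i"
  shows "drinfeld_poly scaleV V act = P"
proof -
  have "(-1) ^ i * drinfeld_theta scaleV V act i / (fact i)\<^sup>2 = coeff P i" for i
    unfolding assms by (simp add: mult.assoc[symmetric] power_mult_distrib[symmetric])
  then have "drinfeld_poly scaleV V act = Sum_any (\<lambda>i. monom (coeff P i) i)"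
    by (simp add: drinfeld_poly_def)
  also have "\<dots> = (\<Sum>i\<le>degree P. monom (coeff P i) i)"
    by (rule Sum_any.expand_superset) (auto simp: le_degree)
  finally show ?thesis by (simp add: poly_as_sum_of_monoms)
qed

theorem theorem17p6:
  fixes scaleV :: "'k::{alg_closed_field, field_char_0} \<Rightarrow> 'v::ab_group_add \<Rightarrow> 'v"
    and V :: "'v set"
    and act :: "'k tetrahedron \<Rightarrow> 'v \<Rightarrow> 'v"
    and N :: nat
    and d :: "nat \<Rightarrow> nat"
    and a :: "nat \<Rightarrow> 'k"
    and scaleW :: "'k \<Rightarrow> 'w::ab_group_add \<Rightarrow> 'w"
    and W :: "nat \<Rightarrow> 'w set"
    and actW :: "nat \<Rightarrow> 'k tetrahedron \<Rightarrow> 'w \<Rightarrow> 'w"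
    and \<tau> :: "(nat \<Rightarrow> 'w) \<Rightarrow> 'v"
  assumes "tet_module scaleV V act"
    and "finite_dimensional_space scaleV V"
    and "irreducible_module scaleV V act"
    and "\<not> trivial_module scaleV V act"
    and "\<And>j. j \<in> {1..N} \<Longrightarrow> is_evaluation_module (d j) (a j) scaleW (W j) (actW j)"
    and "is_module_tensor_product {1..N} scaleW W actW scaleV V act \<tau>"
  shows "drinfeld_poly scaleV V act = (\<Prod>j=1..N. [:1, - a j:] ^ d j)"
proof -
  note ev = assms(5)
  define I where "I = {1..N}"
  interpret lie_module tet_scale tet_bracket scaleV V act by fact
  have W: "vector_space scaleW" "module.subspace scaleW (W j)" if "j \<in> I" for j
  proof -
    from ev[of j] that obtain \<rho> where "lie_module sl2_scale sl2_bracket scaleW (W j) \<rho>"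
      unfolding is_evaluation_module_def I_def by blast
    then interpret W: lie_module sl2_scale sl2_bracket scaleW "W j" \<rho> .
    show "vector_space scaleW" by unfold_locales
    show "W.V.subspace (W j)" by (rule W.subspace_carrier)
  qed
  interpret module_tensor_product tet_scale tet_bracket scaleV V act I scaleW W \<tau> actW
  proof (intro module_tensor_product.intro tensor_product.intro tensor_product_axioms.intro
      module_tensor_product_axioms.intro lie_module_axioms V.vector_space_axioms)
    show "finite I" by (simp add: I_def)
    show "is_tensor_product I scaleW W scaleV V \<tau>"
      using assms(6) unfolding I_def is_module_tensor_product_def by (rule conjunct1)
    show "act \<xi> (\<tau> w) = (\<Sum>j\<in>I. \<tau> (w(j := actW j \<xi> (w j))))" if "w \<in> Pi\<^sub>E I W" for w \<xi>
      using assms(6) that unfolding I_def is_module_tensor_product_def by blast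
  qed (erule W | rule subspace_carrier)+
  define D where "D = sum d I"
  \<comment> \<open>Each generator \<open>x_ik\<close> has its own weight bases in the factors, but
    the resulting eigenvalues on \<open>V\<close> are always the same.\<close>
  have "semisimple_on scaleV V (act (tet_x i k)) \<and>
      eigenvalues_on scaleV V (act (tet_x i k)) = {of_nat D - 2 * of_nat n | n. n \<le> D}"
    if ik: "i \<noteq> k" for i k
  proof -
    have "\<exists>u. W j = module.span scaleW (u ` {..d j}) \<and> (\<forall>n. u n \<in> W j) \<and> (\<forall>n\<le>d j. u n \<noteq> 0) \<and>
        (\<forall>n. actW j (tet_x i k) (u n) = scaleW (of_nat (d j) - 2 * of_nat n) (u n))"
      if "j \<in> I" for j
      using evaluation_module_weight_basis[OF ev ik] that unfolding I_def by metis
    then obtain u where u: "\<And>j. j \<in> I \<Longrightarrow> W j = module.span scaleW (u j ` {..d j})"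
      "\<And>j n. j \<in> I \<Longrightarrow> u j n \<in> W j" "\<And>j n. j \<in> I \<Longrightarrow> n \<le> d j \<Longrightarrow> u j n \<noteq> 0"
      "\<And>j n. j \<in> I \<Longrightarrow>
        actW j (tet_x i k) (u j n) = scaleW (of_nat (d j) - 2 * of_nat n) (u j n)"
      by metis
    show ?thesis unfolding D_def using tensor_weights(1,2)[OF u] by blast
  qed
  then have diam: "tet_diameter scaleV V act = D" by (intro tet_diameter_eqI) auto
  \<comment> \<open>For \<open>\<vartheta>\<close> one basis per factor must diagonalize
    \<open>x_31\<close> and at the same time be a ladder for \<open>tet_e_plus\<close> and
    \<open>tet_e_minus\<close>.\<close>
  let ?ladder = "\<lambda>j u. W j = module.span scaleW (u ` {..d j}) \<and> (\<forall>n. u n \<in> W j) \<and>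
      (\<forall>n\<le>d j. u n \<noteq> 0) \<and>
      (\<forall>n. actW j (tet_x I3 I1) (u n) = scaleW (of_nat (d j) - 2 * of_nat n) (u n)) \<and>
      (\<forall>n. actW j tet_e_plus (u n) = scaleW (a j * of_nat (Suc n)) (u (Suc n))) \<and>
      actW j tet_e_minus (u 0) = 0 \<and>
      (\<forall>n. actW j tet_e_minus (u (Suc n)) = scaleW (of_nat (d j) - of_nat n) (u n))"
  have "\<forall>j\<in>I. \<exists>u. ?ladder j u"
    using evaluation_module_ladder_basis[OF ev] unfolding I_def by metis
  from bchoice[OF this] obtain u where U: "\<forall>j\<in>I. ?ladder j (u j)" ..
  have u: "\<And>j. j \<in> I \<Longrightarrow> W j = module.span scaleW (u j ` {..d j})"
    "\<And>j n. j \<in> I \<Longrightarrow> u j n \<in> W j" "\<And>j n. j \<in> I \<Longrightarrow> n \<le> d j \<Longrightarrow> u j n \<noteq> 0"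
    "\<And>j n. j \<in> I \<Longrightarrow>
      actW j (tet_x I3 I1) (u j n) = scaleW (of_nat (d j) - 2 * of_nat n) (u j n)"
    "\<And>j n. j \<in> I \<Longrightarrow> actW j tet_e_plus (u j n) = scaleW (a j * of_nat (Suc n)) (u j (Suc n))"
    "\<And>j. j \<in> I \<Longrightarrow> actW j tet_e_minus (u j 0) = 0"
    "\<And>j n. j \<in> I \<Longrightarrow> actW j tet_e_minus (u j (Suc n)) = scaleW (of_nat (d j) - of_nat n) (u j n)"
    using U by blast+
  define v where "v = tensor_family u (\<lambda>_. 0)"
  note weights = tensor_weights(3,4)[OF u(1-4), folded D_def v_def]
  have bV: "tensor_family u m \<in> V" for m
    unfolding tensor_family_def using u(2) by (intro tensor_in_V) auto
  \<comment> \<open>Since \<open>x_13 = - x_31\<close>, the eigenvalue \<open>-D\<close> of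
    \<open>x_13\<close> that defines the space of index 0 is the top eigenvalue \<open>D\<close> of
    \<open>x_31\<close>.\<close>
  have "act (tet_x I1 I3) w = - act (tet_x I3 I1) w" if "w \<in> V" for w
    using act_minus_left[OF that, of "tet_x I3 I1"] tet_x_swap[of I1 I3, where 'a = 'k] by simp
  then have "tet_weight_space scaleV V act 0 = eigenspace_on scaleV V (act (tet_x I3 I1)) (of_nat D)"
    by (auto simp: tet_weight_space_def eigenspace_on_def diam)
  then have V0: "tet_weight_space scaleV V act 0 = range (\<lambda>c. scaleV c v)"
    by (simp add: weights(1))
  have "drinfeld_theta scaleV V act i = (-1) ^ i * (fact i)\<^sup>2 * coeff (\<Prod>j\<in>I. [:1, - a j:] ^ d j) i" for i
  proof -
    interpret P: subspace_endomorphism scaleV V "act tet_e_plus" by (rule subspace_endomorphism_act)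
    interpret M: subspace_endomorphism scaleV V "act tet_e_minus" by (rule subspace_endomorphism_act)
    \<comment> \<open>Raising contributes \<open>i!\<close> and the powers of the
      \<open>a j\<close>, lowering contributes another \<open>i!\<close> and the binomials.\<close>
    define \<theta> where "\<theta> = (\<Sum>m\<in>multi_indices I i. (fact i)\<^sup>2 *
        (\<Prod>j\<in>I. of_nat (d j choose m j) * a j ^ m j))"
    have "(act tet_e_plus ^^ i) v
        = (\<Sum>m\<in>multi_indices I i. scaleV (fact i * (\<Prod>j\<in>I. a j ^ m j)) (tensor_family u m))"
      unfolding v_def using u(2,5) by (rule raise_power_tensor_family)
    then have "(act tet_e_minus ^^ i) ((act tet_e_plus ^^ i) v)
        = (\<Sum>m\<in>multi_indices I i. scaleV (fact i * (\<Prod>j\<in>I. a j ^ m j))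
            ((act tet_e_minus ^^ i) (tensor_family u m)))"
      using bV by (simp only: M.funpow_sum_scale)
    also have "\<dots> = (\<Sum>m\<in>multi_indices I i. scaleV ((fact i)\<^sup>2 *
        (\<Prod>j\<in>I. of_nat (d j choose m j) * a j ^ m j)) v)"
      using u(2,6,7)
      by (intro sum.cong refl)
        (simp add: lower_power_tensor_family[of u] v_def power2_eq_square prod.distrib mult_ac)
    also have "\<dots> = scaleV \<theta> v"
      by (simp only: \<theta>_def V.scale_sum_left)
    finally have \<theta>: "(act tet_e_minus ^^ i) ((act tet_e_plus ^^ i) v) = scaleV \<theta> v" .
    have vV: "v \<in> V" using bV by (simp add: v_def)
    have "drinfeld_theta scaleV V act i = \<theta>"
      unfolding drinfeld_theta_def V0
    proof (rule the_equality)
      show "\<forall>w\<in>range (\<lambda>c. scaleV c v).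
          (act tet_e_minus ^^ i) ((act tet_e_plus ^^ i) w) = scaleV \<theta> w"
        using \<theta> vV by (auto simp: P.funpow_scale M.funpow_scale P.funpow_closed mult.commute)
      fix \<eta> assume "\<forall>w\<in>range (\<lambda>c. scaleV c v).
          (act tet_e_minus ^^ i) ((act tet_e_plus ^^ i) w) = scaleV \<eta> w"
      moreover have "v \<in> range (\<lambda>c. scaleV c v)" by (rule range_eqI[of _ _ 1]) simp
      ultimately have "scaleV \<theta> v = scaleV \<eta> v" using \<theta> by metis
      \<comment> \<open>The tensor \<open>v\<close> is nonzero, so it determines the scalar.\<close>
      then show "\<eta> = \<theta>" using weights(2) by simp
    qed
    moreover have "(-1) ^ i * (fact i)\<^sup>2 * coeff (\<Prod>j\<in>I. [:1, - a j:] ^ d j) i = \<theta>"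
      by (simp add: coeff_prod_linear_powers finite_I \<theta>_def sum_distrib_left mult_ac
          flip: power_mult_distrib mult.assoc)
    ultimately show ?thesis by simp
  qed
  then show ?thesis unfolding I_def by (rule drinfeld_poly_eqI)
qed

end
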